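(* Let $f$ be a transcendental entire function. If $f$ has an unbounded Fatou component contained in $BO(f)$, then $BO(f)\cup\{\infty\}$ is a connected subset of the Riemann sphere. Likewise, if $f$ has an unbounded Fatou component contained in $BU(f)$, then $BU(f)\cup\{\infty\}$ is a connected subset of the Riemann sphere.
   Context: For an entire function $f$, $f^n$ denotes its $n$-th iterate. The Julia set $J(f)$ is the set of points in no neighbourhood of which the iterates $(f^n)$ form a normal family; the Fatou set is $F(f)=\mathbb{C}\setminus J(f)$, and its connected components are Fatou components. The escaping set is $I(f) := \{z\in\mathbb{C} : f^n(z)\to\infty\}$. The bounded orbit set is $BO(f) := \{z\in\mathbb{C} : \text{there exists } K>0 \text{ such that } |f^n(z)|<K \text{ for all } n\ge 0\}$. The bungee set is $BU(f) := \mathbb{C}\setminus (I(f)\cup BO(f))$. *)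

theory Defs
  imports "HOL-Complex_Analysis.Complex_Analysis"
begin

definition transcendental_entire :: "(complex \<Rightarrow> complex) \<Rightarrow> bool" where
  "transcendental_entire f \<longleftrightarrow> f holomorphic_on UNIV \<and> \<not> (\<exists>p. \<forall>z. f z = poly p z)"

definition normal_family_on :: "(complex \<Rightarrow> complex) set \<Rightarrow> complex set \<Rightarrow> bool" where
  "normal_family_on F U \<longleftrightarrow>
     (\<forall>s::nat \<Rightarrow> complex \<Rightarrow> complex. (\<forall>n. s n \<in> F) \<longrightarrow>
        (\<exists>r. strict_mono r \<and>
           ((\<exists>g. \<forall>K. K \<subseteq> U \<and> compact K \<longrightarrow> uniform_limit K (\<lambda>k. s (r k)) g sequentially)
            \<or> (\<forall>K. K \<subseteq> U \<and> compact K \<longrightarrow>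
                 (\<forall>B. eventually (\<lambda>k. \<forall>z\<in>K. B \<le> norm (s (r k) z)) sequentially)))))"

definition fatou_set :: "(complex \<Rightarrow> complex) \<Rightarrow> complex set" where
  "fatou_set f = {z. \<exists>U. open U \<and> z \<in> U \<and> normal_family_on {f ^^ n |n. True} U}"

definition julia_set :: "(complex \<Rightarrow> complex) \<Rightarrow> complex set" where
  "julia_set f = UNIV - fatou_set f"

definition fatou_components :: "(complex \<Rightarrow> complex) \<Rightarrow> complex set set" where
  "fatou_components f = components (fatou_set f)"

definition escaping_set :: "(complex \<Rightarrow> complex) \<Rightarrow> complex set" where
  "escaping_set f = {z. filterlim (\<lambda>n. (f ^^ n) z) at_infinity sequentially}"

definition bounded_orbit_set :: "(complex \<Rightarrow> complex) \<Rightarrow> complex set" where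
  "bounded_orbit_set f = {z. \<exists>K>0. \<forall>n. norm ((f ^^ n) z) < K}"

definition bungee_set :: "(complex \<Rightarrow> complex) \<Rightarrow> complex set" where
  "bungee_set f = UNIV - (escaping_set f \<union> bounded_orbit_set f)"

text \<open>The Riemann sphere as the one-point (Alexandroff) compactification of the complex
  plane: points are \<open>Some z\<close> for z in the plane and \<open>None\<close> for infinity.\<close>
definition sphere_open :: "complex option set \<Rightarrow> bool" where
  "sphere_open U \<longleftrightarrow> open (Some -` U) \<and> (None \<in> U \<longrightarrow> compact (UNIV - Some -` U))"

lemma istopology_sphere_open: "istopology sphere_open"
  unfolding istopology_def
proof (intro conjI allI impI)
  fix S T assume S: "sphere_open S" and T: "sphere_open T"
  show "sphere_open (S \<inter> T)"
  proof -
    have "UNIV - Some -` (S \<inter> T) = (UNIV - Some -` S) \<union> (UNIV - Some -` T)" by auto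
    thus ?thesis using S T unfolding sphere_open_def by (auto intro: compact_Un)
  qed
next
  fix K assume K: "\<forall>S\<in>K. sphere_open S"
  show "sphere_open (\<Union>K)"
    unfolding sphere_open_def
  proof (intro conjI impI)
    have e: "Some -` \<Union>K = (\<Union>S\<in>K. Some -` S)" by auto
    show o: "open (Some -` \<Union>K)" unfolding e using K by (auto simp: sphere_open_def)
    assume "None \<in> \<Union>K"
    then obtain S where "S \<in> K" "None \<in> S" by auto
    hence c: "compact (UNIV - Some -` S)" using K by (auto simp: sphere_open_def)
    have "closed (UNIV - Some -` \<Union>K)" using o by (simp add: closed_def Compl_eq_Diff_UNIV double_diff)
    moreover have "UNIV - Some -` \<Union>K \<subseteq> UNIV - Some -` S" using \<open>S \<in> K\<close> by auto
    ultimately show "compact (UNIV - Some -` \<Union>K)" using c compact_Int_closed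
      by (metis inf.absorb_iff2 inf_commute)
  qed
qed

definition riemann_sphere :: "complex option topology" where
  "riemann_sphere = topology sphere_open"

end

theory Submission
  imports Defs
begin

text \<open>
  Let \<open>E\<close> be \<open>BO(f)\<close> or \<open>BU(f)\<close>. If \<open>E \<union> {\<infinity>}\<close> is disconnected, there is a bounded open set \<open>G\<close>
  that meets \<open>E\<close> but whose frontier does not. As \<open>E\<close> is completely invariant, every image
  \<open>f\<^sup>n(G)\<close> has the same property, so it cannot meet the unbounded connected set \<open>U \<subseteq> E\<close>. Hence the
  iterates omit a disc on \<open>G\<close>, they are normal there, and a component \<open>V\<close> of \<open>G \<inter> E\<close> is a bounded
  domain in \<open>E\<close> with frontier outside \<open>E\<close>, whose images are pairwise equal or disjoint.

  If two images coincide, the iterates are uniformly bounded on \<open>V\<close>, hence on its closure, which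
  is absurd. Otherwise let \<open>g\<^sub>n = 1 / (f\<^sup>n - b)\<close> with \<open>b \<in> U\<close>. The sets \<open>g\<^sub>n(V)\<close> are disjoint
  and lie in a fixed disc, so their areas are summable. A domain of small area carries a positive
  superharmonic function that is small at a given point and at least 1 away from it; in other words,
  seen from \<open>z\<^sub>0 \<in> V\<close>, the harmonic measure of the frontier points \<open>w\<close> for which \<open>g\<^sub>n(w)\<close> is far from
  \<open>g\<^sub>n(z\<^sub>0)\<close> is summable in \<open>n\<close>. By a Borel-Cantelli argument some frontier point \<open>w\<close> satisfies
  \<open>g\<^sub>n(w) - g\<^sub>n(z\<^sub>0) \<longlonglongrightarrow> 0\<close>, and therefore \<open>w \<in> E\<close>, a contradiction.
\<close>

section \<open>Connectedness through infinity\<close>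

text \<open>If \<open>E\<close> with infinity splits into two relatively open pieces, the piece
  without infinity is bounded, and the points lying nearer to it than to the rest form a bounded
  open \<open>G\<close> that meets \<open>E\<close> while its frontier avoids \<open>E\<close>. This
  reduces connectedness on the sphere to a statement about plane sets.\<close>

lemma connectedin_riemann_sphere_insert_infinity:
  assumes "\<And>G. open G \<Longrightarrow> bounded G \<Longrightarrow> frontier G \<inter> E = {} \<Longrightarrow> G \<inter> E = {}"
  shows "connectedin riemann_sphere (Some ` E \<union> {None})"
proof -
  have op: "openin riemann_sphere = sphere_open"
    unfolding riemann_sphere_def using istopology_sphere_open by (simp add: topology_inverse')
  have ts: "topspace riemann_sphere = UNIV"
    using openin_subset[of riemann_sphere UNIV] by (auto simp: op sphere_open_def)
  have no_split: False
    if op1: "sphere_open E1" and op2: "sphere_open E2"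
      and cov: "Some ` E \<union> {None} \<subseteq> E1 \<union> E2"
      and dis: "E1 \<inter> E2 \<inter> (Some ` E \<union> {None}) = {}"
      and ne1: "E1 \<inter> (Some ` E \<union> {None}) \<noteq> {}" and inf2: "None \<in> E2" for E1 E2
  proof -
    have inf1: "None \<notin> E1" using dis inf2 by auto
    define O1 O2 where "O1 = Some -` E1" and "O2 = Some -` E2"
    have O: "open O1" "open O2" "compact (- O2)"
      using op1 op2 inf2 by (auto simp: O1_def O2_def sphere_open_def Compl_eq_Diff_UNIV)
    have EO: "E \<subseteq> O1 \<union> O2" "O1 \<inter> O2 \<inter> E = {}"
      using cov dis by (auto simp: O1_def O2_def)
    define A where "A = E \<inter> O1"
    have Ane: "A \<noteq> {}" using ne1 inf1 by (auto simp: A_def O1_def)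
    obtain R where R: "\<And>z. z \<in> - O2 \<Longrightarrow> norm z < R"
      using compact_imp_bounded[OF O(3)] by (auto simp: bounded_pos_less)
    \<comment> \<open>The exterior of the disc of radius \<open>R\<close> is added to the other
      piece of \<open>E\<close>: it makes \<open>G\<close> bounded and \<open>B\<close> nonempty.
      Nonemptiness matters because \<open>infdist\<close> to the empty set is 0.\<close>
    define B where "B = (E \<inter> O2) \<union> {z. R \<le> norm z}"
    have "complex_of_real \<bar>R\<bar> \<in> B" by (simp add: B_def abs_ge_self)
    hence Bne: "B \<noteq> {}" by auto
    have AO2: "A \<subseteq> - O2" using EO by (auto simp: A_def)
    have clA: "closure A \<subseteq> - O2" using AO2 O by (intro closure_minimal) auto
    have "A \<subseteq> O1 \<inter> {z. norm z < R}" using AO2 R by (auto simp: A_def)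
    moreover have "open (O1 \<inter> {z. norm z < R})"
      using O by (intro open_Int open_Collect_less continuous_intros)
    moreover have "O1 \<inter> {z. norm z < R} \<inter> B = {}" using EO by (auto simp: B_def)
    ultimately have AB: "A \<inter> closure B = {}"
      by (metis disjoint_iff open_Int_closure_eq_empty subsetD)
    have BA: "closure A \<inter> B = {}" using clA R by (fastforce simp: B_def)
    \<comment> \<open>\<open>A\<close> and \<open>B\<close> cover \<open>E\<close>, and each misses
      the closure of the other. On the frontier of \<open>G\<close> the two distances agree, so a
      point of \<open>E\<close> there would have distance 0 from both sets.\<close>
    define G where "G = {z. infdist z A < infdist z B}"
    have cont: "continuous_on UNIV (\<lambda>z. infdist z X)" for X :: "complex set"
      by (intro continuous_intros)
    have "open G" unfolding G_def by (intro open_Collect_less cont)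
    moreover have "bounded G"
    proof -
      have "norm z < R" if "z \<in> G" for z
      proof (rule ccontr)
        assume "\<not> norm z < R"
        hence "z \<in> B" by (simp add: B_def)
        hence "infdist z B = 0" by simp
        thus False using that infdist_nonneg[of z A] by (simp add: G_def)
      qed
      thus ?thesis by (meson boundedI less_imp_le)
    qed
    moreover have "frontier G \<inter> E = {}"
    proof -
      have "closure G \<subseteq> {z. infdist z A \<le> infdist z B}"
        by (intro closure_minimal closed_Collect_le cont) (auto simp: G_def)
      hence fr: "infdist z A = infdist z B" if "z \<in> frontier G" for z
        using that \<open>open G\<close> by (force simp: frontier_def interior_open G_def)
      have "z \<notin> frontier G" if "z \<in> E" for z
      proof
        assume zf: "z \<in> frontier G"
        from that EO have "z \<in> A \<or> z \<in> B" by (auto simp: A_def B_def)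
        thus False
        proof
          assume "z \<in> A"
          hence "infdist z B = 0" using fr[OF zf] by simp
          hence "z \<in> closure B" using Bne by (simp add: in_closure_iff_infdist_zero)
          thus False using AB \<open>z \<in> A\<close> by auto
        next
          assume "z \<in> B"
          hence "infdist z A = 0" using fr[OF zf] by simp
          hence "z \<in> closure A" using Ane by (simp add: in_closure_iff_infdist_zero)
          thus False using BA \<open>z \<in> B\<close> by auto
        qed
      qed
      thus ?thesis by auto
    qed
    ultimately have "G \<inter> E = {}" using assms by blast
    moreover obtain a where a: "a \<in> A" using Ane by auto
    have "infdist a B \<noteq> 0"
      using in_closure_iff_infdist_zero[OF Bne, of a] AB a by auto
    hence "a \<in> G" using a infdist_nonneg[of a B] by (simp add: G_def)
    ultimately show False using a by (auto simp: A_def)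
  qed
  show ?thesis
    unfolding connectedin op ts
  proof (intro conjI notI)
    assume "\<exists>E1 E2. sphere_open E1 \<and> sphere_open E2 \<and>
      Some ` E \<union> {None} \<subseteq> E1 \<union> E2 \<and> E1 \<inter> E2 \<inter> (Some ` E \<union> {None}) = {} \<and>
      E1 \<inter> (Some ` E \<union> {None}) \<noteq> {} \<and> E2 \<inter> (Some ` E \<union> {None}) \<noteq> {}"
    then obtain E1 E2 where *: "sphere_open E1" "sphere_open E2"
      "Some ` E \<union> {None} \<subseteq> E1 \<union> E2" "E1 \<inter> E2 \<inter> (Some ` E \<union> {None}) = {}"
      "E1 \<inter> (Some ` E \<union> {None}) \<noteq> {}" "E2 \<inter> (Some ` E \<union> {None}) \<noteq> {}" by (elim exE conjE)
    from *(3) have "None \<in> E1 \<union> E2" by blast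
    then consider "None \<in> E2" | "None \<in> E1" by blast
    thus False
    proof cases
      case 1 show False by (rule no_split[OF *(1-5) 1])
    next
      case 2
      have "Some ` E \<union> {None} \<subseteq> E2 \<union> E1" "E2 \<inter> E1 \<inter> (Some ` E \<union> {None}) = {}"
        using *(3,4) by (simp_all only: Un_commute Int_commute)
      thus False by (rule no_split[OF *(2,1) _ _ *(6) 2])
    qed
  qed auto
qed

section \<open>Orbit types and normality\<close>

text \<open>Bounded, escaping and bungee orbits are the three classes of this relation. Both sets of
  the theorem are closed under it, so one argument serves for both.\<close>

definition same_orbit_type :: "(complex \<Rightarrow> complex) \<Rightarrow> complex \<Rightarrow> complex \<Rightarrow> bool" where
  "same_orbit_type f z w \<longleftrightarrow>
     (z \<in> bounded_orbit_set f \<longleftrightarrow> w \<in> bounded_orbit_set f) \<and>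
     (z \<in> escaping_set f \<longleftrightarrow> w \<in> escaping_set f)"

lemma bounded_orbit_set_iff: "z \<in> bounded_orbit_set f \<longleftrightarrow> Bseq (\<lambda>n. (f ^^ n) z)"
proof
  assume "z \<in> bounded_orbit_set f"
  thus "Bseq (\<lambda>n. (f ^^ n) z)"
    by (auto simp: bounded_orbit_set_def Bseq_def intro: less_imp_le)
next
  assume "Bseq (\<lambda>n. (f ^^ n) z)"
  then obtain K where "K > 0" "\<And>n. norm ((f ^^ n) z) \<le> K" by (auto simp: Bseq_def)
  hence "K + 1 > 0 \<and> (\<forall>n. norm ((f ^^ n) z) < K + 1)"
    by (metis add_pos_pos le_less_trans less_add_one zero_less_one)
  thus "z \<in> bounded_orbit_set f" unfolding bounded_orbit_set_def by blast
qed

lemma escaping_set_iff: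
  "z \<in> escaping_set f \<longleftrightarrow> filterlim (\<lambda>n. norm ((f ^^ n) z)) at_top sequentially"
  unfolding escaping_set_def mem_Collect_eq
  by (rule filterlim_at_infinity_conv_norm_at_top)

lemma same_orbit_type_image: "same_orbit_type f z (f z)"
proof -
  have eq: "(f ^^ n) (f z) = (f ^^ (Suc n)) z" for n by (simp add: funpow_swap1)
  show ?thesis
    unfolding same_orbit_type_def bounded_orbit_set_iff escaping_set_def mem_Collect_eq eq
    using Bseq_Suc_iff[of "\<lambda>n. (f ^^ n) z"]
          filterlim_sequentially_Suc[of "\<lambda>n. (f ^^ n) z" at_infinity]
    by blast
qed

lemma same_orbit_type_funpow: "same_orbit_type f z ((f ^^ n) z)"
proof (induction n)
  case 0 show ?case by (simp add: same_orbit_type_def)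
next
  case (Suc n)
  thus ?case using same_orbit_type_image[of f "(f ^^ n) z"] by (auto simp: same_orbit_type_def)
qed

lemma same_orbit_type_sym: "same_orbit_type f z w \<Longrightarrow> same_orbit_type f w z"
  by (auto simp: same_orbit_type_def)

text \<open>A failure of boundedness or of escape at one point is witnessed along some sequence of
  iterates. By normality a subsequence either converges at both points or tends to infinity at both,
  which transfers the failure to the other point.\<close>

lemma same_orbit_type_if_normal:
  assumes nf: "normal_family_on {f ^^ n |n. True} U" and "x \<in> U" "y \<in> U"
  shows "same_orbit_type f x y"
proof -
  have lim: "\<exists>q. strict_mono (q :: nat \<Rightarrow> nat) \<and>
     ((\<exists>g. \<forall>z\<in>{x,y}. (\<lambda>k. (f ^^ r (q k)) z) \<longlonglongrightarrow> g z) \<or>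
      (\<forall>z\<in>{x,y}. filterlim (\<lambda>k. norm ((f ^^ r (q k)) z)) at_top sequentially))" for r :: "nat \<Rightarrow> nat"
  proof -
    obtain q :: "nat \<Rightarrow> nat" where q: "strict_mono q"
      "(\<exists>g. \<forall>K. K \<subseteq> U \<and> compact K \<longrightarrow> uniform_limit K (\<lambda>k. f ^^ r (q k)) g sequentially)
            \<or> (\<forall>K. K \<subseteq> U \<and> compact K \<longrightarrow>
                 (\<forall>B. eventually (\<lambda>k. \<forall>z\<in>K. B \<le> norm ((f ^^ r (q k)) z)) sequentially))"
      using nf[unfolded normal_family_on_def, rule_format, of "\<lambda>n. f ^^ r n"] by blast
    have K: "{x,y} \<subseteq> U \<and> compact {x,y}" using assms by auto
    from q(2) show ?thesis
    proof
      assume "\<exists>g. \<forall>K. K \<subseteq> U \<and> compact K \<longrightarrow> uniform_limit K (\<lambda>k. f ^^ r (q k)) g sequentially"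
      then obtain g where "uniform_limit {x,y} (\<lambda>k. f ^^ r (q k)) g sequentially" using K by blast
      hence "\<forall>z\<in>{x,y}. (\<lambda>k. (f ^^ r (q k)) z) \<longlonglongrightarrow> g z"
        by (auto intro: tendsto_uniform_limitI)
      thus ?thesis using q(1) by blast
    next
      assume "\<forall>K. K \<subseteq> U \<and> compact K \<longrightarrow>
                 (\<forall>B. eventually (\<lambda>k. \<forall>z\<in>K. B \<le> norm ((f ^^ r (q k)) z)) sequentially)"
      hence *: "\<And>B. eventually (\<lambda>k. \<forall>z\<in>{x,y}. B \<le> norm ((f ^^ r (q k)) z)) sequentially" using K by blast
      have "\<forall>z\<in>{x,y}. filterlim (\<lambda>k. norm ((f ^^ r (q k)) z)) at_top sequentially"
        unfolding filterlim_at_top using * by (force elim: eventually_mono)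
      thus ?thesis using q(1) by blast
    qed
  qed
  have not_both: False if X: "Bseq X" "filterlim (\<lambda>n. norm (X n)) at_top sequentially" for X :: "nat \<Rightarrow> complex"
  proof -
    obtain K where K: "\<And>n. norm (X n) \<le> K" using X(1) by (auto simp: Bseq_def)
    have "\<forall>\<^sub>F n in sequentially. K + 1 \<le> norm (X n)"
      using that(2) unfolding filterlim_at_top by blast
    then obtain n where "K + 1 \<le> norm (X n)" by (auto simp: eventually_sequentially)
    thus False using K[of n] by linarith
  qed
  have A: "b \<in> bounded_orbit_set f" if "a \<in> {x,y}" "b \<in> {x,y}" "a \<in> bounded_orbit_set f" for a b
  proof (rule ccontr)
    assume "b \<notin> bounded_orbit_set f"
    have "\<exists>m. norm ((f ^^ m) b) \<ge> real n + 1" for n :: nat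
    proof (rule ccontr)
      assume "\<nexists>m. norm ((f ^^ m) b) \<ge> real n + 1"
      hence "real n + 1 > 0 \<and> (\<forall>m. norm ((f ^^ m) b) < real n + 1)" by (simp add: not_le)
      thus False using \<open>b \<notin> bounded_orbit_set f\<close> unfolding bounded_orbit_set_def by blast
    qed
    \<comment> \<open>The exponents \<open>r n\<close> need not increase, since normality is defined
      for arbitrary sequences from the family; growth of the values already excludes a finite
      limit.\<close>
    then obtain r where r: "\<And>n::nat. norm ((f ^^ r n) b) \<ge> real n + 1" by metis
    obtain q :: "nat \<Rightarrow> nat" where q: "strict_mono q"
     "(\<exists>g. \<forall>z\<in>{x,y}. (\<lambda>k. (f ^^ r (q k)) z) \<longlonglongrightarrow> g z) \<or>
      (\<forall>z\<in>{x,y}. filterlim (\<lambda>k. norm ((f ^^ r (q k)) z)) at_top sequentially)" using lim by blast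
    have rb: "filterlim (\<lambda>k. norm ((f ^^ r (q k)) b)) at_top sequentially"
    proof (rule filterlim_at_top_mono)
      show "filterlim (\<lambda>k. real (q k)) at_top sequentially"
        using filterlim_compose[OF filterlim_real_sequentially filterlim_subseq[OF q(1)]] by simp
      show "\<forall>\<^sub>F k in sequentially. real (q k) \<le> norm ((f ^^ r (q k)) b)"
        proof (intro always_eventually allI)
        fix k show "real (q k) \<le> norm ((f ^^ r (q k)) b)" using r[of "q k"] by linarith
      qed
    qed
    from q(2) show False
    proof
      assume "\<exists>g. \<forall>z\<in>{x,y}. (\<lambda>k. (f ^^ r (q k)) z) \<longlonglongrightarrow> g z"
      hence "Bseq (\<lambda>k. (f ^^ r (q k)) b)"
        using that(2) by (meson convergentI convergent_imp_Bseq)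
      thus False using not_both rb by blast
    next
      assume "\<forall>z\<in>{x,y}. filterlim (\<lambda>k. norm ((f ^^ r (q k)) z)) at_top sequentially"
      hence "filterlim (\<lambda>k. norm ((f ^^ r (q k)) a)) at_top sequentially" using that by blast
      moreover have "Bseq (\<lambda>k. (f ^^ r (q k)) a)"
        using that(3) by (auto simp: bounded_orbit_set_iff Bseq_def)
      ultimately show False using not_both by blast
    qed
  qed
  have B: "b \<in> escaping_set f" if "a \<in> {x,y}" "b \<in> {x,y}" "a \<in> escaping_set f" for a b
  proof (rule ccontr)
    assume "b \<notin> escaping_set f"
    then obtain Z where "\<not> (\<forall>\<^sub>F n in sequentially. Z \<le> norm ((f ^^ n) b))"
      unfolding escaping_set_iff filterlim_at_top by blast
    hence "\<forall>N. \<exists>n\<ge>N. norm ((f ^^ n) b) < Z"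
      unfolding eventually_sequentially by (metis linorder_not_less)
    \<comment> \<open>Here \<open>r N \<ge> N\<close> makes \<open>r (q k)\<close> tend to infinity,
      so that the escape of \<open>a\<close> is inherited along these exponents.\<close>
    then obtain r where r: "\<And>N. r N \<ge> N" "\<And>N. norm ((f ^^ r N) b) < Z" by metis
    obtain q :: "nat \<Rightarrow> nat" where q: "strict_mono q"
     "(\<exists>g. \<forall>z\<in>{x,y}. (\<lambda>k. (f ^^ r (q k)) z) \<longlonglongrightarrow> g z) \<or>
      (\<forall>z\<in>{x,y}. filterlim (\<lambda>k. norm ((f ^^ r (q k)) z)) at_top sequentially)" using lim by blast
    have fr: "filterlim (\<lambda>k. r (q k)) at_top sequentially"
      by (rule filterlim_at_top_mono[OF filterlim_subseq[OF q(1)]]) (use r in auto)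
    have ra: "filterlim (\<lambda>k. norm ((f ^^ r (q k)) a)) at_top sequentially"
      using that(3) unfolding escaping_set_iff by (rule filterlim_compose[OF _ fr])
    have "Bseq (\<lambda>k. (f ^^ r (q k)) b)"
      using r(2) by (intro BseqI'[of _ Z]) (simp add: less_imp_le)
    moreover from q(2) have "filterlim (\<lambda>k. norm ((f ^^ r (q k)) b)) at_top sequentially"
    proof
      assume "\<exists>g. \<forall>z\<in>{x,y}. (\<lambda>k. (f ^^ r (q k)) z) \<longlonglongrightarrow> g z"
      hence "Bseq (\<lambda>k. (f ^^ r (q k)) a)"
        using that(1) by (meson convergentI convergent_imp_Bseq)
      thus ?thesis using not_both ra by blast
    qed (use that in blast)
    ultimately show False using not_both by blast
  qed
  show ?thesis unfolding same_orbit_type_def using A[of x y] A[of y x] B[of x y] B[of y x] by auto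
qed

text \<open>The functions \<open>1 / (h - b)\<close> are bounded by \<open>1 / \<rho>\<close>, so
  Montel gives a locally uniform limit \<open>g\<close>. They have no zeros, hence by Hurwitz
  \<open>g\<close> is zero-free or identically zero. In the first case the original functions
  converge to \<open>b + 1 / g\<close>, in the second they tend to infinity.\<close>

lemma normal_family_on_ball_omitting_disc:
  assumes hol: "\<And>h. h \<in> F \<Longrightarrow> h holomorphic_on ball c r"
    and omit: "\<And>h z. h \<in> F \<Longrightarrow> z \<in> ball c r \<Longrightarrow> \<rho> \<le> norm (h z - b)" and "\<rho> > 0"
  shows "normal_family_on F (ball c r)"
  unfolding normal_family_on_def
proof (intro allI impI)
  fix s :: "nat \<Rightarrow> complex \<Rightarrow> complex" assume s: "\<forall>n. s n \<in> F"
  define t where "t = (\<lambda>n z. inverse (s n z - b))"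
  have nz: "s n z \<noteq> b" if "z \<in> ball c r" for n z
    using omit[OF s[rule_format, of n] that] \<open>\<rho> > 0\<close> by auto
  have holt: "t n holomorphic_on ball c r" for n
    unfolding t_def using s hol nz by (intro holomorphic_intros) auto
  have bt: "norm (t n z) \<le> inverse \<rho>" if "z \<in> ball c r" for n z
    using omit[OF s[rule_format, of n] that] \<open>\<rho> > 0\<close>
    by (auto simp: t_def norm_inverse intro: le_imp_inverse_le)
  obtain g q where g: "g holomorphic_on ball c r" "strict_mono (q :: nat \<Rightarrow> nat)"
    and lim: "\<And>K. \<lbrakk>compact K; K \<subseteq> ball c r\<rbrakk> \<Longrightarrow> uniform_limit K (t \<circ> q) g sequentially"
    proof (rule Montel[of "ball c r" "range t" t])
    show "\<exists>B. \<forall>h\<in>range t. \<forall>z\<in>K. norm (h z) \<le> B" if "compact K" "K \<subseteq> ball c r" for K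
      using bt that by (intro exI[of _ "inverse \<rho>"]) auto
  qed (use holt in auto)
  have s_eq: "s n = (\<lambda>z. b + inverse (t n z))" for n by (simp add: t_def)
  have tnz: "t n z \<noteq> 0" if "z \<in> ball c r" for n z using nz[OF that] by (simp add: t_def)
  have const_or: "(\<forall>z\<in>ball c r. g z = 0) \<or> (\<forall>z\<in>ball c r. g z \<noteq> 0)"
  proof (cases "g constant_on ball c r")
    case True thus ?thesis by (auto simp: constant_on_def)
  next
    case False
    have "g z \<noteq> 0" if "z \<in> ball c r" for z
      by (rule Hurwitz_no_zeros[of "ball c r" "t \<circ> q" g]) (use holt g lim False tnz that in auto)
    thus ?thesis by blast
  qed
  show "\<exists>r'. strict_mono r' \<and>
           ((\<exists>g. \<forall>K. K \<subseteq> ball c r \<and> compact K \<longrightarrow> uniform_limit K (\<lambda>k. s (r' k)) g sequentially)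
            \<or> (\<forall>K. K \<subseteq> ball c r \<and> compact K \<longrightarrow>
                 (\<forall>B. eventually (\<lambda>k. \<forall>z\<in>K. B \<le> norm (s (r' k) z)) sequentially)))"
  proof (intro exI[of _ q] conjI g(2))
    from const_or show "(\<exists>g. \<forall>K. K \<subseteq> ball c r \<and> compact K \<longrightarrow> uniform_limit K (\<lambda>k. s (q k)) g sequentially)
            \<or> (\<forall>K. K \<subseteq> ball c r \<and> compact K \<longrightarrow>
                 (\<forall>B. eventually (\<lambda>k. \<forall>z\<in>K. B \<le> norm (s (q k) z)) sequentially))"
    proof
      assume z: "\<forall>z\<in>ball c r. g z = 0"
      have "eventually (\<lambda>k. \<forall>z\<in>K. B \<le> norm (s (q k) z)) sequentially"
        if K: "K \<subseteq> ball c r" "compact K" for K and B :: real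
      proof -
        \<comment> \<open>When \<open>norm (t n z) < e\<close>, the point \<open>s n z\<close> is
          further than \<open>\<bar>B\<bar> + norm b + 1\<close> from \<open>b\<close>, and the
          triangle inequality gives the bound \<open>B\<close>.\<close>
        define e where "e = inverse (\<bar>B\<bar> + norm b + 1)"
        have "e > 0" by (simp add: e_def add_nonneg_pos)
        have "\<forall>\<^sub>F k in sequentially. \<forall>z\<in>K. dist ((t \<circ> q) k z) (g z) < e"
          using uniform_limitD[OF lim[OF K(2,1)] \<open>e > 0\<close>] .
        thus ?thesis
        proof (rule eventually_mono, intro ballI)
          fix k z assume *: "\<forall>z\<in>K. dist ((t \<circ> q) k z) (g z) < e" and zK: "z \<in> K"
          have "norm (t (q k) z) < e" using * zK z K by (force simp: dist_norm)
          moreover have "norm (t (q k) z) > 0" using tnz[of z "q k"] zK K by auto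
          ultimately have "inverse e < norm (inverse (t (q k) z))"
            by (metis less_imp_inverse_less norm_inverse)
          hence "\<bar>B\<bar> + norm b + 1 < norm (s (q k) z - b)" by (simp add: s_eq e_def)
          thus "B \<le> norm (s (q k) z)" using norm_triangle_ineq4[of "s (q k) z" b] by linarith
        qed
      qed
      thus ?thesis by blast
    next
      assume nzg: "\<forall>z\<in>ball c r. g z \<noteq> 0"
      have "uniform_limit K (\<lambda>k. s (q k)) (\<lambda>z. b + inverse (g z)) sequentially"
        if K: "K \<subseteq> ball c r" "compact K" for K
      proof -
        have "continuous_on K (\<lambda>z. norm (g z))"
          using g(1) K by (intro continuous_intros holomorphic_on_imp_continuous_on) (auto intro: holomorphic_on_subset)
        obtain m where m: "m > 0" "\<And>z. z \<in> K \<Longrightarrow> m \<le> norm (g z)"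
        proof (cases "K = {}")
          case False
          obtain x where "x \<in> K" "\<And>y. y \<in> K \<Longrightarrow> norm (g x) \<le> norm (g y)"
            using continuous_attains_inf[OF K(2) False \<open>continuous_on K (\<lambda>z. norm (g z))\<close>] by blast
          thus ?thesis using that[of "norm (g x)"] nzg K by auto
        qed (use that[of 1] in auto)
        have "uniform_limit K (\<lambda>n z. inverse ((t \<circ> q) n z)) (inverse \<circ> g) sequentially"
          by (rule uniform_lim_inverse[OF lim[OF K(2,1)] _ m(1)]) (use m in auto)
        hence "uniform_limit K (\<lambda>n z. b + inverse ((t \<circ> q) n z)) (\<lambda>z. b + (inverse \<circ> g) z) sequentially"
          by (intro uniform_limit_intros)
        thus ?thesis by (simp add: s_eq o_def)
      qed
      thus ?thesis by blast
    qed
  qed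
qed

section \<open>A discrete Laplacian\<close>

text \<open>Divided by \<open>r^2\<close> this is the five-point finite-difference Laplacian. The
  codomain is general so that it applies both to holomorphic functions and to real functions built
  from them.\<close>

definition lap4 :: "(complex \<Rightarrow> 'a::real_normed_field) \<Rightarrow> complex \<Rightarrow> real \<Rightarrow> 'a" where
  "lap4 u z r = u (z + of_real r) + u (z - of_real r) + u (z + \<i> * of_real r) + u (z - \<i> * of_real r) - 4 * u z"

text \<open>
  For a function that is twice differentiable at \<open>z\<close> this says that its Laplacian there is at most \<open>c\<close>.
  Being a one-sided condition, it passes to functions touched from above (\<open>lap_le_touch\<close>), which
  lets the barriers below be merely \<open>C\<^sup>1\<close>.
\<close>
definition lap_le :: "(complex \<Rightarrow> real) \<Rightarrow> complex \<Rightarrow> real \<Rightarrow> bool" where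
  "lap_le u z c \<longleftrightarrow> (\<forall>e>0. \<forall>\<^sub>F r in at_right 0. lap4 u z r \<le> (c + e) * r\<^sup>2)"

lemma eventually_lap4_nodes:
  assumes "eventually P (nhds z)"
  shows "\<forall>\<^sub>F r in at_right 0. P (z + of_real r) \<and> P (z - of_real r) \<and>
           P (z + \<i> * of_real r) \<and> P (z - \<i> * of_real r)"
proof -
  have "\<forall>\<^sub>F r in at_right 0. P (z + d * of_real r)" for d
  proof -
    have "((\<lambda>r. z + d * of_real r) \<longlongrightarrow> z + d * of_real 0) (at_right (0::real))"
      by (intro tendsto_intros)
    hence "filterlim (\<lambda>r. z + d * of_real r) (nhds z) (at_right (0::real))" by simp
    thus ?thesis using assms by (rule eventually_compose_filterlim[rotated])
  qed
  from this[of 1] this[of "-1"] this[of \<i>] this[of "-\<i>"] show ?thesis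
    by eventually_elim auto
qed

lemma lap_le_of_tendsto:
  assumes "((\<lambda>r. lap4 u z r / of_real (r\<^sup>2)) \<longlongrightarrow> c) (at_right 0)"
  shows "lap_le u z c"
  unfolding lap_le_def
proof (intro allI impI)
  fix e :: real assume "e > 0"
  have "\<forall>\<^sub>F r in at_right 0. lap4 u z r / of_real (r\<^sup>2) < c + e"
    using order_tendstoD(2)[OF assms, of "c + e"] \<open>e > 0\<close> by simp
  moreover have "\<forall>\<^sub>F r in at_right 0. (r::real) > 0" by (rule eventually_at_right_less)
  ultimately show "\<forall>\<^sub>F r in at_right 0. lap4 u z r \<le> (c + e) * r\<^sup>2"
    by eventually_elim (simp add: field_simps)
qed

lemma lap_le_add:
  assumes "lap_le u z c" "lap_le v z d"
  shows "lap_le (\<lambda>w. u w + v w) z (c + d)"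
  unfolding lap_le_def
proof (intro allI impI)
  fix e :: real assume "e > 0"
  hence "\<forall>\<^sub>F r in at_right 0. lap4 u z r \<le> (c + e/2) * r\<^sup>2"
    "\<forall>\<^sub>F r in at_right 0. lap4 v z r \<le> (d + e/2) * r\<^sup>2"
    using assms unfolding lap_le_def by auto
  thus "\<forall>\<^sub>F r in at_right 0. lap4 (\<lambda>w. u w + v w) z r \<le> (c + d + e) * r\<^sup>2"
    by eventually_elim (simp add: lap4_def algebra_simps)
qed

lemma lap_le_const: "lap_le (\<lambda>w. k) z 0"
  unfolding lap_le_def by (simp add: lap4_def)

lemma lap_le_cmult:
  assumes "lap_le u z c" "k > 0"
  shows "lap_le (\<lambda>w. k * u w) z (k * c)"
  unfolding lap_le_def
proof (intro allI impI)
  fix e :: real assume "e > 0"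
  hence "\<forall>\<^sub>F r in at_right 0. lap4 u z r \<le> (c + e/k) * r\<^sup>2"
    using assms unfolding lap_le_def by auto
  thus "\<forall>\<^sub>F r in at_right 0. lap4 (\<lambda>w. k * u w) z r \<le> (k * c + e) * r\<^sup>2"
  proof eventually_elim
    case (elim r)
    have "lap4 (\<lambda>w. k * u w) z r = k * lap4 u z r" by (simp add: lap4_def algebra_simps)
    also have "\<dots> \<le> k * ((c + e/k) * r\<^sup>2)" using elim \<open>k > 0\<close> by (intro mult_left_mono) auto
    also have "\<dots> = (k * c + e) * r\<^sup>2" using \<open>k > 0\<close> by (simp add: field_simps)
    finally show ?case .
  qed
qed

lemma lap_le_sum:
  assumes "finite I" "\<And>i. i \<in> I \<Longrightarrow> lap_le (u i) z (c i)"
  shows "lap_le (\<lambda>w. \<Sum>i\<in>I. u i w) z (\<Sum>i\<in>I. c i)"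
  using assms
proof (induction I rule: finite_induct)
  case empty show ?case by (simp add: lap_le_const)
next
  case (insert i I)
  have "lap_le (\<lambda>w. u i w + (\<Sum>i\<in>I. u i w)) z (c i + (\<Sum>i\<in>I. c i))"
    using insert by (intro lap_le_add) auto
  thus ?case using insert by simp
qed

lemma lap_le_mono:
  assumes "lap_le u z c" "c \<le> d"
  shows "lap_le u z d"
  unfolding lap_le_def
proof (intro allI impI)
  fix e :: real assume "e > 0"
  hence "\<forall>\<^sub>F r in at_right 0. lap4 u z r \<le> (c + e) * r\<^sup>2"
    using assms unfolding lap_le_def by auto
  thus "\<forall>\<^sub>F r in at_right 0. lap4 u z r \<le> (d + e) * r\<^sup>2"
  proof eventually_elim
    case (elim r)
    have "(c + e) * r\<^sup>2 \<le> (d + e) * r\<^sup>2" using assms by (intro mult_right_mono) auto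
    thus ?case using elim by linarith
  qed
qed

text \<open>The outer nodes enter \<open>lap4\<close> with positive sign, and at the centre, which
  enters with negative sign, the two functions agree.\<close>

lemma lap_le_touch:
  assumes "lap_le h z c" "\<forall>\<^sub>F w in nhds z. u w \<le> h w" "u z = h z"
  shows "lap_le u z c"
  unfolding lap_le_def
proof (intro allI impI)
  fix e :: real assume "e > 0"
  hence "\<forall>\<^sub>F r in at_right 0. lap4 h z r \<le> (c + e) * r\<^sup>2"
    using assms unfolding lap_le_def by auto
  thus "\<forall>\<^sub>F r in at_right 0. lap4 u z r \<le> (c + e) * r\<^sup>2"
    using eventually_lap4_nodes[OF assms(2)]
    by eventually_elim (use assms(3) in \<open>simp add: lap4_def\<close>)
qed

text \<open>At a local minimum the outer values are at least the central one, so \<open>lap4\<close>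
  is nonnegative for small \<open>r\<close>. Strict negativity of \<open>c\<close> is asked for
  because the bound 0 still permits a positive \<open>lap4\<close> of order o(r^2).\<close>

lemma not_local_min_if_lap_le_neg:
  assumes "lap_le u z c" "c < 0"
  shows "\<not> (\<forall>\<^sub>F w in nhds z. u z \<le> u w)"
proof
  assume "\<forall>\<^sub>F w in nhds z. u z \<le> u w"
  note * = eventually_lap4_nodes[OF this]
  have "\<forall>\<^sub>F r in at_right 0. lap4 u z r \<le> (c + (- c/2)) * r\<^sup>2"
    using assms unfolding lap_le_def by (metis neg_0_less_iff_less half_gt_zero minus_divide_left)
  moreover have "\<forall>\<^sub>F r in at_right 0. (r::real) > 0" by (rule eventually_at_right_less)
  ultimately have "\<forall>\<^sub>F r in at_right (0::real). False"
    using *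
  proof eventually_elim
    case (elim r)
    have "0 \<le> lap4 u z r" using elim(3) by (simp add: lap4_def)
    also have "\<dots> \<le> c/2 * r\<^sup>2" using elim by simp
    also have "\<dots> < 0" using elim assms by (intro mult_neg_pos) auto
    finally show False by simp
  qed
  thus False by simp
qed

text \<open>Expand \<open>F\<close> to second order at \<open>z\<close>, with a holomorphic
  remainder factor \<open>F2\<close> from two removable-singularity quotients. The linear terms of
  opposite nodes cancel, and the squared steps are \<open>r^2\<close>, \<open>r^2\<close>,
  \<open>-r^2\<close>, \<open>-r^2\<close>, so the values of \<open>F2\<close> cancel in the
  limit.\<close>

lemma lap4_holomorphic:
  assumes hol: "F holomorphic_on A" and A: "open A" "z \<in> A"
  shows "((\<lambda>r. lap4 F z r / of_real (r\<^sup>2)) \<longlongrightarrow> 0) (at_right 0)"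
proof -
  define F1 where "F1 = (\<lambda>w. if w = z then deriv F z else (F w - F z) / (w - z))"
  define F2 where "F2 = (\<lambda>w. if w = z then deriv F1 z else (F1 w - F1 z) / (w - z))"
  have h1: "F1 holomorphic_on A" unfolding F1_def by (rule pole_lemma_open[OF hol A(1)])
  have h2: "F2 holomorphic_on A" unfolding F2_def by (rule pole_lemma_open[OF h1 A(1)])
  have eq: "F w = F z + (w - z) * F1 z + (w - z)\<^sup>2 * F2 w" for w
  proof (cases "w = z")
    case False
    have "F w = F z + (w - z) * F1 w" using False by (simp add: F1_def)
    also have "F1 w = F1 z + (w - z) * F2 w" using False by (simp add: F2_def)
    finally show ?thesis by (simp add: power2_eq_square algebra_simps)
  qed simp
  have cont: "isCont F2 z"
    using h2 A holomorphic_on_imp_continuous_on continuous_on_eq_continuous_at by blast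
  have lim: "((\<lambda>r. F2 (z + d * of_real r)) \<longlongrightarrow> F2 z) (at_right (0::real))" for d
  proof (rule isCont_tendsto_compose[OF cont])
    have "((\<lambda>r. z + d * of_real r) \<longlongrightarrow> z + d * of_real 0) (at_right (0::real))"
      by (intro tendsto_intros)
    thus "((\<lambda>r. z + d * of_real r) \<longlongrightarrow> z) (at_right (0::real))" by simp
  qed
  have "((\<lambda>r. F2 (z + 1 * of_real r) + F2 (z + (-1) * of_real r)
             - F2 (z + \<i> * of_real r) - F2 (z + (-\<i>) * of_real r))
          \<longlongrightarrow> F2 z + F2 z - F2 z - F2 z) (at_right (0::real))"
    by (intro tendsto_intros lim)
  moreover have "\<forall>\<^sub>F r in at_right (0::real). 
     F2 (z + 1 * of_real r) + F2 (z + (-1) * of_real r)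
             - F2 (z + \<i> * of_real r) - F2 (z + (-\<i>) * of_real r)
     = lap4 F z r / of_real (r\<^sup>2)"
    using eventually_at_right_less[of "0::real"]
  proof eventually_elim
    case (elim r)
    have "lap4 F z r = of_real (r\<^sup>2) * (F2 (z + of_real r) + F2 (z - of_real r)
             - F2 (z + \<i> * of_real r) - F2 (z - \<i> * of_real r))"
      unfolding lap4_def
      by (subst eq[of "z + of_real r"], subst eq[of "z - of_real r"],
          subst eq[of "z + \<i> * of_real r"], subst eq[of "z - \<i> * of_real r"])
         (simp add: power_mult_distrib algebra_simps)
    thus ?case using elim by simp
  qed
  ultimately show ?thesis by (simp add: tendsto_cong)
qed

lemma lap_le_Re_holomorphic:
  assumes hol: "F holomorphic_on A" and A: "open A" "z \<in> A"
  shows "lap_le (\<lambda>w. Re (F w)) z 0"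
proof (rule lap_le_of_tendsto)
  have "((\<lambda>r. Re (lap4 F z r / of_real (r\<^sup>2))) \<longlongrightarrow> Re 0) (at_right 0)"
    by (intro tendsto_Re lap4_holomorphic[OF assms])
  moreover have "(\<lambda>r. Re (lap4 F z r / of_real (r\<^sup>2))) = (\<lambda>r. lap4 (\<lambda>w. Re (F w)) z r / of_real (r\<^sup>2))"
    by (simp add: lap4_def Re_divide_of_real del: of_real_power)
  ultimately show "((\<lambda>r. lap4 (\<lambda>w. Re (F w)) z r / of_real (r\<^sup>2)) \<longlongrightarrow> 0) (at_right 0)"
    by (simp only: zero_complex.sel)
qed

text \<open>Expanding the squared modulus about \<open>F z\<close> leaves four squared difference
  quotients, each tending to the squared modulus of the derivative, and a cross term containing
  \<open>lap4 F\<close>, which vanishes in the limit.\<close>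

lemma lap4_norm_sq_holomorphic:
  assumes hol: "F holomorphic_on A" and A: "open A" "z \<in> A"
  shows "((\<lambda>r. lap4 (\<lambda>w. (norm (F w))\<^sup>2) z r / of_real (r\<^sup>2)) \<longlongrightarrow> 4 * (norm (deriv F z))\<^sup>2) (at_right 0)"
proof -
  have D: "(F has_field_derivative deriv F z) (at z)"
    using hol A holomorphic_derivI by blast
  define Q where "Q = (\<lambda>d r. (norm ((F (z + d * of_real r) - F z) / (d * of_real r)))\<^sup>2)"
  have Q: "((\<lambda>r. Q d r) \<longlongrightarrow> (norm (deriv F z))\<^sup>2) (at_right (0::real))" if "d \<noteq> 0" for d
  proof -
    have "((\<lambda>h. (F (z + h) - F z) / h) \<longlongrightarrow> deriv F z) (at 0)"
      using D by (simp add: DERIV_def)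
    moreover have "filterlim (\<lambda>r. d * of_real r) (at 0) (at_right (0::real))"
    proof -
      have "((\<lambda>r. d * of_real r) \<longlongrightarrow> d * of_real 0) (at_right (0::real))" by (intro tendsto_intros)
      moreover have "\<forall>\<^sub>F r in at_right (0::real). d * of_real r \<noteq> 0"
        using eventually_at_right_less[of "0::real"] by eventually_elim (use that in auto)
      ultimately show ?thesis by (simp add: filterlim_at)
    qed
    ultimately have "((\<lambda>r. (F (z + d * of_real r) - F z) / (d * of_real r)) \<longlongrightarrow> deriv F z) (at_right (0::real))"
      by (rule filterlim_compose)
    thus ?thesis unfolding Q_def by (intro tendsto_intros)
  qed
  have "((\<lambda>r. Q 1 r + Q (-1) r + Q \<i> r + Q (-\<i>) r + 2 * Re (cnj (F z) * (lap4 F z r / of_real (r\<^sup>2))))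
     \<longlongrightarrow> (norm (deriv F z))\<^sup>2 + (norm (deriv F z))\<^sup>2 + (norm (deriv F z))\<^sup>2 + (norm (deriv F z))\<^sup>2 
         + 2 * Re (cnj (F z) * 0)) (at_right 0)"
    by (intro tendsto_intros Q lap4_holomorphic[OF assms]) auto
  moreover have "\<forall>\<^sub>F r in at_right (0::real). 
     Q 1 r + Q (-1) r + Q \<i> r + Q (-\<i>) r + 2 * Re (cnj (F z) * (lap4 F z r / of_real (r\<^sup>2)))
     = lap4 (\<lambda>w. (norm (F w))\<^sup>2) z r / of_real (r\<^sup>2)"
    using eventually_at_right_less[of "0::real"]
  proof eventually_elim
    case (elim r)
    have pol: "(norm a)\<^sup>2 = (norm (a - b))\<^sup>2 + 2 * Re (cnj b * (a - b)) + (norm b)\<^sup>2" for a b :: complex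
      by (simp add: cmod_power2) (simp add: power2_eq_square algebra_simps)
    have Qr: "Q d r = (norm (F (z + d * of_real r) - F z))\<^sup>2 / r\<^sup>2" if "norm d = 1" for d
      using that elim by (simp add: Q_def norm_divide norm_mult power_divide)
    have R: "Re (cnj (F z) * (lap4 F z r / of_real (r\<^sup>2))) = Re (cnj (F z) * lap4 F z r) / r\<^sup>2"
      by (metis Re_divide_of_real times_divide_eq_right)
    have "lap4 (\<lambda>w. (norm (F w))\<^sup>2) z r = (norm (F (z + of_real r) - F z))\<^sup>2 + (norm (F (z - of_real r) - F z))\<^sup>2
       + (norm (F (z + \<i> * of_real r) - F z))\<^sup>2 + (norm (F (z - \<i> * of_real r) - F z))\<^sup>2
       + 2 * Re (cnj (F z) * lap4 F z r)"
      unfolding lap4_def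
      by (subst pol[of "F (z + of_real r)" "F z"], subst pol[of "F (z - of_real r)" "F z"],
          subst pol[of "F (z + \<i> * of_real r)" "F z"], subst pol[of "F (z - \<i> * of_real r)" "F z"])
         (simp add: algebra_simps)
    thus ?case by (simp add: Qr R add_divide_distrib)
  qed
  ultimately show ?thesis by (simp add: tendsto_cong)
qed

text \<open>Since \<open>lap_le\<close> is one-sided, the negative needs its own bound; the barrier
  uses both signs.\<close>

lemma lap_le_norm_sq_holomorphic:
  assumes hol: "F holomorphic_on A" and A: "open A" "z \<in> A"
  shows "lap_le (\<lambda>w. (norm (F w))\<^sup>2) z (4 * (norm (deriv F z))\<^sup>2)"
    and "lap_le (\<lambda>w. - (norm (F w))\<^sup>2) z (- 4 * (norm (deriv F z))\<^sup>2)"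
proof -
  note L = lap4_norm_sq_holomorphic[OF assms]
  show "lap_le (\<lambda>w. (norm (F w))\<^sup>2) z (4 * (norm (deriv F z))\<^sup>2)"
    by (rule lap_le_of_tendsto[OF L])
  have "lap4 (\<lambda>w. - (norm (F w))\<^sup>2) z r = - lap4 (\<lambda>w. (norm (F w))\<^sup>2) z r" for r
    by (simp add: lap4_def)
  thus "lap_le (\<lambda>w. - (norm (F w))\<^sup>2) z (- 4 * (norm (deriv F z))\<^sup>2)"
    using tendsto_minus[OF L] by (intro lap_le_of_tendsto) simp
qed

section \<open>Barriers on domains of small area\<close>

text \<open>
  The logarithmic potential of the uniform density 1 on the disc of centre \<open>a\<close> and radius \<open>R\<close>,
  normalised to be nonnegative on the concentric disc of radius \<open>D\<close>: its Laplacian is \<open>-1\<close> inside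
  the disc and 0 outside.
\<close>
definition disc_potential :: "complex \<Rightarrow> real \<Rightarrow> real \<Rightarrow> complex \<Rightarrow> real" where
  "disc_potential a R D x =
     R\<^sup>2 / 2 * ln (D / max (dist x a) R) + (R\<^sup>2 - (min (dist x a) R)\<^sup>2) / 4"

lemma continuous_on_disc_potential:
  assumes "R > 0" "D > 0"
  shows "continuous_on A (disc_potential a R D)"
proof -
  have "max (dist x a) R > 0" for x using assms by (simp add: less_max_iff_disj)
  hence "max (dist x a) R \<noteq> 0" "D / max (dist x a) R > 0" for x
    using assms by (simp_all add: less_imp_neq[symmetric])
  thus ?thesis unfolding disc_potential_def[abs_def] using assms
    by (intro continuous_intros) (auto simp: less_imp_neq[symmetric])
qed

text \<open>Inside the disc this is \<open>ln x \<le> x - 1\<close> at the squared ratio of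
  \<open>dist x a\<close> to \<open>R\<close>; elsewhere the two sides agree. The logarithm serves
  as a touching majorant on and outside the circle, and as a size estimate far from
  \<open>a\<close>.\<close>

lemma disc_potential_le_log:
  assumes "R > 0" "D > 0" "x \<noteq> a"
  shows "disc_potential a R D x \<le> R\<^sup>2 / 2 * ln (D / dist x a)"
proof (cases "dist x a \<ge> R")
  case True
  thus ?thesis by (simp add: disc_potential_def max_def min_def)
next
  case False
  define t where "t = dist x a"
  have t: "0 < t" "t < R" using False assms by (auto simp: t_def)
  have "ln ((t/R)\<^sup>2) \<le> (t/R)\<^sup>2 - 1" using t by (intro ln_le_minus_one) auto
  hence "2 * (ln t - ln R) \<le> t\<^sup>2 / R\<^sup>2 - 1"
    using t assms by (simp add: ln_realpow ln_div power_divide)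
  hence "R\<^sup>2 * (2 * (ln t - ln R)) \<le> R\<^sup>2 * (t\<^sup>2 / R\<^sup>2 - 1)" by (intro mult_left_mono) auto
  also have "\<dots> = t\<^sup>2 - R\<^sup>2" using assms by (simp add: field_simps)
  finally have *: "R\<^sup>2 * (2 * (ln t - ln R)) \<le> t\<^sup>2 - R\<^sup>2" .
  have "disc_potential a R D x = R\<^sup>2 / 2 * (ln D - ln R) + (R\<^sup>2 - t\<^sup>2) / 4"
    using t assms by (simp add: disc_potential_def t_def[symmetric] max_def min_def ln_div)
  also have "\<dots> \<le> R\<^sup>2 / 2 * (ln D - ln t)"
    using * by (simp add: field_simps)
  also have "\<dots> = R\<^sup>2 / 2 * ln (D / dist x a)" using t assms by (simp add: ln_div t_def[symmetric])
  finally show ?thesis .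
qed

lemma disc_potential_nonneg:
  assumes "R > 0" "R \<le> D" "dist x a \<le> D"
  shows "disc_potential a R D x \<ge> 0"
proof -
  have "0 \<le> ln (D / max (dist x a) R)" using assms by (intro ln_ge_zero) (simp add: le_divide_eq less_max_iff_disj)
  moreover have "(min (dist x a) R)\<^sup>2 \<le> R\<^sup>2" using assms by (intro power_mono) auto
  ultimately show ?thesis unfolding disc_potential_def by (intro add_nonneg_nonneg mult_nonneg_nonneg) auto
qed

text \<open>Composition with holomorphic \<open>g\<close> multiplies the Laplacian by the squared
  modulus of \<open>deriv g z\<close>. Inside the disc the potential is a constant minus a quarter
  of the squared distance; elsewhere, the circle included, it is touched from above by a harmonic
  logarithm.\<close>

lemma lap_le_disc_potential:
  assumes RD: "R > 0" "D > 0" and hol: "g holomorphic_on A" and A: "open A" "z \<in> A"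
  shows "lap_le (\<lambda>w. disc_potential a R D (g w)) z (if dist (g z) a < R then - (norm (deriv g z))\<^sup>2 else 0)"
proof -
  have cont: "isCont g z"
    using hol A holomorphic_on_imp_continuous_on continuous_on_eq_continuous_at by blast
  hence lim: "(g \<longlongrightarrow> g z) (nhds z)" by (simp add: continuous_at tendsto_at_iff_tendsto_nhds)
  show ?thesis
  proof (cases "dist (g z) a < R")
    case True
    have ev: "\<forall>\<^sub>F w in nhds z. dist (g w) a < R"
      using True by (intro order_tendstoD(2)[OF tendsto_dist[OF lim tendsto_const]])
    have hol': "(\<lambda>w. g w - a) holomorphic_on A" using hol by (intro holomorphic_intros)
    have der: "deriv (\<lambda>w. g w - a) z = deriv g z"
      using holomorphic_derivI[OF hol A] by (intro DERIV_imp_deriv) (auto intro!: derivative_eq_intros)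
    have "lap_le (\<lambda>w. (1/4) * (- (norm (g w - a))\<^sup>2) + (R\<^sup>2 / 2 * ln (D / R) + R\<^sup>2/4)) z
            ((1/4) * (- 4 * (norm (deriv (\<lambda>w. g w - a) z))\<^sup>2) + 0)"
      by (intro lap_le_add lap_le_const lap_le_cmult lap_le_norm_sq_holomorphic(2)[OF hol' A]) auto
    hence "lap_le (\<lambda>w. disc_potential a R D (g w)) z ((1/4) * (- 4 * (norm (deriv (\<lambda>w. g w - a) z))\<^sup>2) + 0)"
    proof (rule lap_le_touch)
      show "\<forall>\<^sub>F w in nhds z. disc_potential a R D (g w)
              \<le> (1/4) * (- (norm (g w - a))\<^sup>2) + (R\<^sup>2 / 2 * ln (D / R) + R\<^sup>2/4)"
        using ev by eventually_elim (simp add: disc_potential_def max_def min_def dist_norm field_simps)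
      show "disc_potential a R D (g z) = (1/4) * (- (norm (g z - a))\<^sup>2) + (R\<^sup>2 / 2 * ln (D / R) + R\<^sup>2/4)"
        using True by (simp add: disc_potential_def max_def min_def dist_norm field_simps)
    qed
    thus ?thesis using True by (simp add: der)
  next
    case False
    hence ne: "g z \<noteq> a" using RD by auto
    \<comment> \<open>Dividing by \<open>g z - a\<close> gives \<open>h z = 1\<close>, so the
      principal branch \<open>Ln\<close> is holomorphic near that value.\<close>
    define h where "h = (\<lambda>w. (g w - a) / (g z - a))"
    have holh: "h holomorphic_on A" unfolding h_def using hol ne by (intro holomorphic_intros) auto
    define A' where "A' = A \<inter> h -` {w. Re w > 0}"
    have A': "open A'"
      unfolding A'_def by (rule continuous_open_preimage[OF holomorphic_on_imp_continuous_on[OF holh] A(1)])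
        (rule open_halfspace_Re_gt)
    have zA': "z \<in> A'" using A ne by (simp add: A'_def h_def)
    have np: "h w \<notin> \<real>\<^sub>\<le>\<^sub>0" if "w \<in> A'" for w
      using that complex_nonpos_Reals_iff[of "h w"] by (auto simp: A'_def)
    have holL: "(\<lambda>w. Ln (h w)) holomorphic_on A'"
      using np holomorphic_on_subset[OF holh, of A'] by (intro holomorphic_intros) (auto simp: A'_def)
    have holL': "(\<lambda>w. - (R\<^sup>2 / 2) * Ln (h w)) holomorphic_on A'"
      by (intro holomorphic_intros holL)
    have "lap_le (\<lambda>w. Re (- (R\<^sup>2 / 2) * Ln (h w)) + R\<^sup>2 / 2 * ln (D / dist (g z) a)) z (0 + 0)"
      by (intro lap_le_add lap_le_const lap_le_Re_holomorphic[OF holL' A' zA'])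
    hence "lap_le (\<lambda>w. disc_potential a R D (g w)) z (0 + 0)"
    proof (rule lap_le_touch)
      have "\<forall>\<^sub>F w in nhds z. w \<in> A'" using A' zA' by (rule eventually_nhds_in_open)
      thus "\<forall>\<^sub>F w in nhds z. disc_potential a R D (g w)
              \<le> Re (- (R\<^sup>2 / 2) * Ln (h w)) + R\<^sup>2 / 2 * ln (D / dist (g z) a)"
      proof eventually_elim
        case (elim w)
        have hn: "h w \<noteq> 0" using np[OF elim] by auto
        hence gw: "g w \<noteq> a" by (auto simp: h_def)
        have "Re (Ln (h w)) = ln (norm (h w))" using hn by simp
        also have "\<dots> = ln (dist (g w) a) - ln (dist (g z) a)"
          using gw ne by (simp add: h_def norm_divide dist_norm ln_div)
        finally have *: "Re (Ln (h w)) = ln (dist (g w) a) - ln (dist (g z) a)" .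
        have re: "Re (- (R\<^sup>2 / 2) * Ln (h w)) = - (R\<^sup>2 / 2) * Re (Ln (h w))"
          by (simp del: of_real_power add: of_real_power[symmetric])
        have "disc_potential a R D (g w) \<le> R\<^sup>2 / 2 * ln (D / dist (g w) a)"
          by (rule disc_potential_le_log[OF RD gw])
        also have "\<dots> = - (R\<^sup>2 / 2) * Re (Ln (h w)) + R\<^sup>2 / 2 * ln (D / dist (g z) a)"
          unfolding * using gw ne RD by (simp add: ln_div field_simps)
        finally show ?case unfolding re .
      qed
      show "disc_potential a R D (g z) = Re (- (R\<^sup>2 / 2) * Ln (h z)) + R\<^sup>2 / 2 * ln (D / dist (g z) a)"
        using False ne by (simp add: disc_potential_def h_def max_def min_def)
    qed
    thus ?thesis using False by simp
  qed
qed

text \<open>Vitali selection among discs contained in \<open>W\<close> gives disjoint ones whose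
  five-fold enlargements cover \<open>Q\<close>. Disjointness bounds their total area by that of
  \<open>W\<close>, and the factor \<open>pi\<close> is dropped.\<close>

lemma vitali_balls_in_open:
  fixes W :: "complex set"
  assumes "open W" "W \<subseteq> ball 0 M" "compact Q" "Q \<subseteq> W" "M > 0"
  obtains C r where "finite C" "C \<subseteq> Q" "\<forall>a\<in>C. 0 < r a \<and> r a \<le> M"
    "Q \<subseteq> (\<Union>a\<in>C. ball a (5 * r a))" "(\<Sum>a\<in>C. (r a)\<^sup>2) \<le> measure lborel W"
proof -
  have "\<exists>r. 0 < r \<and> r \<le> M \<and> ball a r \<subseteq> W" if "a \<in> Q" for a
  proof -
    obtain e where "e > 0" "ball a e \<subseteq> W" using assms \<open>a \<in> Q\<close> by (meson openE subsetD)
    thus ?thesis using \<open>M > 0\<close> by (intro exI[of _ "min e M"]) (auto simp: subset_iff)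
  qed
  then obtain r where r: "\<And>a. a \<in> Q \<Longrightarrow> 0 < r a \<and> r a \<le> M \<and> ball a (r a) \<subseteq> W" by metis
  have "Q \<subseteq> (\<Union>a\<in>Q. ball a (r a))" using r by force
  then obtain K where K: "K \<subseteq> Q" "finite K" "Q \<subseteq> (\<Union>a\<in>K. ball a (r a))"
    using compactE_image[OF assms(3), of Q "\<lambda>a. ball a (r a)"] by auto
  obtain C where C: "countable C" "C \<subseteq> K"
     "pairwise (\<lambda>i j. disjnt (ball i (r i)) (ball j (r j))) C"
     "Q \<subseteq> (\<Union>i\<in>C. ball i (5 * r i))"
    by (rule Vitali_covering_lemma_balls[where S = Q and K = K and a = "\<lambda>a. a" and r = r and B = M]) (use K r in blast)+
  have finC: "finite C" using C K finite_subset by blast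
  have fmW: "W \<in> fmeasurable lborel"
  proof (rule fmeasurableI)
    show "W \<in> sets lborel" using assms(1) by simp
    have "bounded W" using assms(2) bounded_ball bounded_subset by blast
    thus "emeasure lborel W < \<infinity>" by (rule emeasure_bounded_finite)
  qed
  have "(\<Sum>a\<in>C. (r a)\<^sup>2) \<le> (\<Sum>a\<in>C. measure lborel (ball a (r a)))"
  proof (rule sum_mono)
    fix a assume "a \<in> C"
    hence "r a > 0" using r C K by auto
    hence "measure lborel (ball a (r a)) = pi * (r a)\<^sup>2"
      by (simp add: content_ball unit_ball_vol_2)
    moreover have "1 * (r a)\<^sup>2 \<le> pi * (r a)\<^sup>2" using pi_gt3 by (intro mult_right_mono) auto
    ultimately show "(r a)\<^sup>2 \<le> measure lborel (ball a (r a))" by simp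
  qed
  also have "\<dots> = measure lborel (\<Union>a\<in>C. ball a (r a))"
    by (rule measure_UNION'[symmetric])
       (use finC C in \<open>auto intro!: fmeasurableI emeasure_bounded_finite\<close>)
  also have "\<dots> \<le> measure lborel W"
    by (rule measure_mono_fmeasurable) (use fmW r C K in auto)
  finally show ?thesis using that[of C r] finC C K r by blast
qed

text \<open>A bump that is 0 near \<open>p\<close> and at least 1 at distance
  \<open>\<delta>\<close> is corrected by disc potentials covering the part of \<open>Q\<close>
  where its Laplacian may be positive; their total mass is controlled by the area of
  \<open>W\<close>. The last property concerns compositions with \<open>g\<close> because barriers
  for different maps are later added on one domain.\<close>

lemma thin_domain_barrier:
  fixes W :: "complex set"
  assumes W: "open W" "W \<subseteq> ball 0 M" and Q: "compact Q" "Q \<subseteq> W"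
    and p: "norm p < M" and d: "\<delta> > 0"
  obtains S :: "complex \<Rightarrow> real" where "continuous_on UNIV S"
    "\<And>x. norm x < M \<Longrightarrow> 0 \<le> S x"
    "\<And>x. norm x < M \<Longrightarrow> \<delta> \<le> dist x p \<Longrightarrow> 1 \<le> S x"
    "S p \<le> 8000 * M * measure lborel W / \<delta> ^ 3"
    "\<And>g A z. open A \<Longrightarrow> g holomorphic_on A \<Longrightarrow> z \<in> A \<Longrightarrow> g z \<in> Q \<Longrightarrow> dist (g z) p \<le> \<delta>
       \<Longrightarrow> lap_le (\<lambda>w. S (g w)) z 0"
proof -
  have M: "M > 0" using p norm_ge_zero[of p] by linarith
  define Q' where "Q' = Q \<inter> {x. \<delta>/2 \<le> dist x p}"
  have "closed {x. \<delta>/2 \<le> dist x p}" by (intro closed_Collect_le continuous_intros)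
  hence cQ': "compact Q'" unfolding Q'_def using Q by (intro compact_Int_closed)
  have Q'W: "Q' \<subseteq> W" using Q by (auto simp: Q'_def)
  obtain C r where C: "finite C" "C \<subseteq> Q'" "\<forall>a\<in>C. 0 < r a \<and> r a \<le> M"
    "Q' \<subseteq> (\<Union>a\<in>C. ball a (5 * r a))" "(\<Sum>a\<in>C. (r a)\<^sup>2) \<le> measure lborel W"
    by (rule vitali_balls_in_open[OF W cQ' Q'W M])
  \<comment> \<open>The factor \<open>c\<close> makes \<open>\<psi>\<close> equal to 1 at distance
    \<open>\<delta>\<close>, as \<open>(3/4 * \<delta>^2)^2 = 9/16 * \<delta>^4\<close>; and
    \<open>k = 16 * c * \<delta>^2\<close>.\<close>
  define c where "c = 16 / (9 * \<delta> ^ 4)"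
  define k where "k = 256 / (9 * \<delta>\<^sup>2)"
  have ck: "c > 0" "k > 0" using d by (auto simp: c_def k_def)
  \<comment> \<open>The Laplacian of \<open>\<psi>\<close> is at most \<open>k\<close> where \<open>\<delta>/2 \<le> dist x p \<le> \<delta>\<close>; there \<open>k\<close> times a disc
    potential compensates it. Keeping the discs away from \<open>p\<close> makes the potentials small at \<open>p\<close>.\<close>
  define \<psi> where "\<psi> = (\<lambda>x. c * (max 0 ((dist x p)\<^sup>2 - \<delta>\<^sup>2/4))\<^sup>2)"
  \<comment> \<open>The radius \<open>10 * M\<close> exceeds both \<open>5 * r a \<le> 5 * M\<close>
    and the mutual distances, below \<open>2 * M\<close>, of points in the disc of radius
    \<open>M\<close>; hence the potentials are nonnegative there.\<close>
  define P where "P = (\<lambda>x. \<Sum>a\<in>C. disc_potential a (5 * r a) (10 * M) x)"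
  define S where "S = (\<lambda>x. \<psi> x + k * P x)"
  have normC: "norm a < M" if "a \<in> C" for a
    using that C(2) Q W by (auto simp: Q'_def subset_iff)
  have P0: "P x \<ge> 0" if "norm x < M" for x
    unfolding P_def
  proof (intro sum_nonneg disc_potential_nonneg)
    fix a assume a: "a \<in> C"
    show "5 * r a > 0" "5 * r a \<le> 10 * M" using bspec[OF C(3) a] by auto
    have "dist x a \<le> norm x + norm a" by (metis dist_norm norm_triangle_ineq4)
    thus "dist x a \<le> 10 * M" using that normC[OF a] M by linarith
  qed
  have psi0: "\<psi> x \<ge> 0" for x unfolding \<psi>_def using ck by simp
  show ?thesis
  proof (rule that[of S])
    have "continuous_on UNIV P" unfolding P_def
    proof (intro continuous_on_sum)
      fix a assume "a \<in> C"
      thus "continuous_on UNIV (disc_potential a (5 * r a) (10 * M))"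
        using C(3) M by (intro continuous_on_disc_potential) auto
    qed
    thus "continuous_on UNIV S" unfolding S_def \<psi>_def by (intro continuous_intros)
  next
    fix x :: complex assume x: "norm x < M"
    show "0 \<le> S x" using P0[OF x] psi0[of x] ck by (simp add: S_def)
    assume dx: "\<delta> \<le> dist x p"
    hence "\<delta>\<^sup>2 \<le> (dist x p)\<^sup>2" using d by (intro power_mono) auto
    hence "3/4 * \<delta>\<^sup>2 \<le> max 0 ((dist x p)\<^sup>2 - \<delta>\<^sup>2/4)" by (intro max.coboundedI2) linarith
    hence "(3/4 * \<delta>\<^sup>2)\<^sup>2 \<le> (max 0 ((dist x p)\<^sup>2 - \<delta>\<^sup>2/4))\<^sup>2" by (intro power_mono) auto
    hence "c * (3/4 * \<delta>\<^sup>2)\<^sup>2 \<le> \<psi> x" using ck by (simp add: \<psi>_def)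
    moreover have "c * (3/4 * \<delta>\<^sup>2)\<^sup>2 = 1"
      using d by (simp add: c_def power_mult_distrib power_divide flip: power_mult)
    ultimately show "1 \<le> S x" using P0[OF x] ck by (simp add: S_def add_increasing2)
  next
    have "P p \<le> (\<Sum>a\<in>C. (r a)\<^sup>2 * (250 * M / \<delta>))"
      unfolding P_def
    proof (rule sum_mono)
      fix a assume a: "a \<in> C"
      have da: "dist p a \<ge> \<delta>/2" using a C(2) by (auto simp: Q'_def dist_commute)
      hence ne: "p \<noteq> a" using d by auto
      have "disc_potential a (5 * r a) (10 * M) p \<le> (5 * r a)\<^sup>2 / 2 * ln (10 * M / dist p a)"
        using bspec[OF C(3) a] M ne by (intro disc_potential_le_log) auto
      also have "\<dots> \<le> (5 * r a)\<^sup>2 / 2 * (20 * M / \<delta>)"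
      proof (rule mult_left_mono)
        have "ln (10 * M / dist p a) \<le> 10 * M / dist p a - 1" using M ne by (intro ln_le_minus_one) auto
        also have "\<dots> \<le> 10 * M / dist p a" by simp
        also have "\<dots> \<le> 10 * M / (\<delta>/2)" using da d M ne by (intro divide_left_mono mult_pos_pos) auto
        finally show "ln (10 * M / dist p a) \<le> 20 * M / \<delta>" by simp
      qed auto
      also have "\<dots> = (r a)\<^sup>2 * (250 * M / \<delta>)" by (simp add: power2_eq_square)
      finally show "disc_potential a (5 * r a) (10 * M) p \<le> (r a)\<^sup>2 * (250 * M / \<delta>)" .
    qed
    also have "\<dots> = (\<Sum>a\<in>C. (r a)\<^sup>2) * (250 * M / \<delta>)" by (rule sum_distrib_right[symmetric])
    also have "\<dots> \<le> measure lborel W * (250 * M / \<delta>)" using C(5) M d by (intro mult_right_mono) auto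
    finally have "k * P p \<le> k * (measure lborel W * (250 * M / \<delta>))" using ck by (intro mult_left_mono) auto
    \<comment> \<open>The numerator is 256, from \<open>k\<close>, times
      \<open>250 = 25/2 * 20\<close>; the constant 8000 rounds \<open>64000/9\<close> up.\<close>
    also have "\<dots> = (64000/9) * (M * measure lborel W / \<delta> ^ 3)"
      by (simp add: k_def power3_eq_cube power2_eq_square mult_ac)
    also have "\<dots> \<le> 8000 * (M * measure lborel W / \<delta> ^ 3)" using M d by (intro mult_right_mono) auto
    finally show "S p \<le> 8000 * M * measure lborel W / \<delta> ^ 3"
      using d by (simp add: S_def \<psi>_def max_def mult.assoc)
  next
    fix g A z assume A: "open A" "g holomorphic_on A" "z \<in> A" and gz: "g z \<in> Q" "dist (g z) p \<le> \<delta>"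
    define s where "s = (norm (deriv g z))\<^sup>2"
    define b where "b = (\<lambda>a. if dist (g z) a < 5 * r a then - s else 0)"
    have "lap_le (\<lambda>w. P (g w)) z (\<Sum>a\<in>C. b a)" unfolding P_def
    proof (rule lap_le_sum[OF C(1)])
      fix a assume "a \<in> C"
      thus "lap_le (\<lambda>w. disc_potential a (5 * r a) (10 * M) (g w)) z (b a)"
        unfolding b_def s_def using C(3) M A by (intro lap_le_disc_potential[of _ _ _ A]) auto
    qed
    hence kP: "lap_le (\<lambda>w. k * P (g w)) z (k * (\<Sum>a\<in>C. b a))" using ck by (intro lap_le_cmult)
    have b0: "b a \<le> 0" for a by (simp add: b_def s_def)
    show "lap_le (\<lambda>w. S (g w)) z 0"
    proof (cases "\<delta>/2 \<le> dist (g z) p")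
      case True
      hence "g z \<in> Q'" using gz by (simp add: Q'_def)
      then obtain a0 where a0: "a0 \<in> C" "dist (g z) a0 < 5 * r a0"
        using C(4) by (auto simp: dist_commute)
      \<comment> \<open>One enlarged disc containing \<open>g z\<close> already contributes
        \<open>- s\<close>, and all other terms are at most 0.\<close>
      have "(\<Sum>a\<in>C. b a) = b a0 + (\<Sum>a\<in>C - {a0}. b a)" using C(1) a0 by (simp add: sum.remove)
      also have "\<dots> \<le> b a0" using b0 by (simp add: sum_nonpos)
      also have "\<dots> = - s" using a0 by (simp add: b_def)
      finally have bs: "(\<Sum>a\<in>C. b a) \<le> - s" .
      \<comment> \<open>The square of \<open>norm (G w)^2 - \<delta>^2/4\<close> expands into the
        squared moduli of the holomorphic functions \<open>G^2\<close> and \<open>G\<close> and a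
        constant, so its Laplacian is known.\<close>
      define G where "G = (\<lambda>w. g w - p)"
      have holG: "G holomorphic_on A" "(\<lambda>w. (G w)\<^sup>2) holomorphic_on A"
        unfolding G_def by (intro holomorphic_intros A)+
      have dg: "(g has_field_derivative deriv g z) (at z)" by (rule holomorphic_derivI[OF A(2,1,3)])
      have dG: "deriv G z = deriv g z" unfolding G_def
        by (rule DERIV_imp_deriv) (auto intro!: derivative_eq_intros dg)
      have dG2: "deriv (\<lambda>w. (G w)\<^sup>2) z = 2 * G z * deriv g z" unfolding G_def
        by (rule DERIV_imp_deriv) (auto intro!: derivative_eq_intros dg)
      have "lap_le (\<lambda>w. c * (((norm ((G w)\<^sup>2))\<^sup>2 + \<delta>\<^sup>2/2 * (- (norm (G w))\<^sup>2)) + \<delta>^4/16)) z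
          (c * ((4 * (norm (deriv (\<lambda>w. (G w)\<^sup>2) z))\<^sup>2 + \<delta>\<^sup>2/2 * (- 4 * (norm (deriv G z))\<^sup>2)) + 0))"
        using ck d A holG
        by (intro lap_le_cmult lap_le_add lap_le_const lap_le_norm_sq_holomorphic[of _ A]) auto
      also have "(\<lambda>w. c * (((norm ((G w)\<^sup>2))\<^sup>2 + \<delta>\<^sup>2/2 * (- (norm (G w))\<^sup>2)) + \<delta>^4/16))
          = (\<lambda>w. c * ((dist (g w) p)\<^sup>2 - \<delta>\<^sup>2/4)\<^sup>2)"
      proof
        fix w
        have "dist (g w) p = norm (G w)" by (simp add: G_def dist_norm)
        moreover have "((t\<^sup>2)\<^sup>2 + \<delta>\<^sup>2/2 * (- t\<^sup>2)) + \<delta>^4/16 = (t\<^sup>2 - \<delta>\<^sup>2/4)\<^sup>2" for t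
          by (simp add: power2_eq_square power4_eq_xxxx field_simps)
        ultimately show "c * (((norm ((G w)\<^sup>2))\<^sup>2 + \<delta>\<^sup>2/2 * (- (norm (G w))\<^sup>2)) + \<delta>^4/16)
            = c * ((dist (g w) p)\<^sup>2 - \<delta>\<^sup>2/4)\<^sup>2" by (simp only: norm_power)
      qed
      finally have "lap_le (\<lambda>w. \<psi> (g w)) z
          (c * ((4 * (norm (deriv (\<lambda>w. (G w)\<^sup>2) z))\<^sup>2 + \<delta>\<^sup>2/2 * (- 4 * (norm (deriv G z))\<^sup>2)) + 0))"
      proof (rule lap_le_touch)
        \<comment> \<open>Dropping the \<open>max\<close> gives a smooth majorant that agrees with
          \<open>\<psi>\<close> at \<open>g z\<close>, even on the circle of radius
          \<open>\<delta>/2\<close>, where \<open>\<psi>\<close> is only once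
          differentiable.\<close>
        have "(max 0 t)\<^sup>2 \<le> t\<^sup>2" for t :: real by (simp add: max_def)
        thus "\<forall>\<^sub>F w in nhds z. \<psi> (g w) \<le> c * ((dist (g w) p)\<^sup>2 - \<delta>\<^sup>2/4)\<^sup>2"
          using ck by (intro always_eventually allI) (simp add: \<psi>_def)
        have "(\<delta>/2)\<^sup>2 \<le> (dist (g z) p)\<^sup>2" using True d by (intro power_mono) auto
        thus "\<psi> (g z) = c * ((dist (g z) p)\<^sup>2 - \<delta>\<^sup>2/4)\<^sup>2" by (simp add: \<psi>_def max_def power_divide)
      qed
      from lap_le_add[OF this kP] have L: "lap_le (\<lambda>w. S (g w)) z
          (c * ((4 * (norm (deriv (\<lambda>w. (G w)\<^sup>2) z))\<^sup>2 + \<delta>\<^sup>2/2 * (- 4 * (norm (deriv G z))\<^sup>2)) + 0)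
            + k * (\<Sum>a\<in>C. b a))" by (simp add: S_def)
      show ?thesis
      proof (rule lap_le_mono[OF L])
        \<comment> \<open>Since \<open>norm (G z) \<le> \<delta>\<close>, the bump contributes at
          most \<open>16 * c * \<delta>^2 * s = k * s\<close>, which the potentials cancel.\<close>
        have "(norm (G z))\<^sup>2 \<le> \<delta>\<^sup>2" using gz by (intro power_mono) (auto simp: G_def dist_norm)
        hence "(norm (G z))\<^sup>2 * s \<le> \<delta>\<^sup>2 * s" by (intro mult_right_mono) (auto simp: s_def)
        moreover have "0 \<le> \<delta>\<^sup>2 * s" by (simp add: s_def)
        ultimately have "16 * ((norm (G z))\<^sup>2 * s) - 2 * (\<delta>\<^sup>2 * s) \<le> 16 * (\<delta>\<^sup>2 * s)"
          by linarith
        hence "c * (16 * ((norm (G z))\<^sup>2 * s) - 2 * (\<delta>\<^sup>2 * s)) \<le> c * (16 * (\<delta>\<^sup>2 * s))"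
          using ck by (intro mult_left_mono) auto
        also have "\<dots> = k * s" using d by (simp add: c_def k_def power2_eq_square power4_eq_xxxx)
        also have "\<dots> \<le> - (k * (\<Sum>a\<in>C. b a))" using mult_left_mono[OF bs, of k] ck by simp
        finally have "c * (16 * ((norm (G z))\<^sup>2 * s) - 2 * (\<delta>\<^sup>2 * s)) + k * (\<Sum>a\<in>C. b a) \<le> 0" by simp
        moreover have "(4 * (norm (deriv (\<lambda>w. (G w)\<^sup>2) z))\<^sup>2 + \<delta>\<^sup>2/2 * (- 4 * (norm (deriv G z))\<^sup>2)) + 0
           = 16 * ((norm (G z))\<^sup>2 * s) - 2 * (\<delta>\<^sup>2 * s)"
          by (simp add: dG dG2 s_def norm_mult power_mult_distrib)
        ultimately show "c * ((4 * (norm (deriv (\<lambda>w. (G w)\<^sup>2) z))\<^sup>2 + \<delta>\<^sup>2/2 * (- 4 * (norm (deriv G z))\<^sup>2)) + 0)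
            + k * (\<Sum>a\<in>C. b a) \<le> 0" by simp
      qed
    next
      case False
      have "isCont g z"
        using A holomorphic_on_imp_continuous_on continuous_on_eq_continuous_at by blast
      hence lim: "(g \<longlongrightarrow> g z) (nhds z)" by (simp add: continuous_at tendsto_at_iff_tendsto_nhds)
      have ev: "\<forall>\<^sub>F w in nhds z. dist (g w) p < \<delta>/2"
        using False by (intro order_tendstoD(2)[OF tendsto_dist[OF lim tendsto_const]]) auto
      have z0: "\<psi> x = 0" if "dist x p < \<delta>/2" for x
      proof -
        have "(dist x p)\<^sup>2 \<le> (\<delta>/2)\<^sup>2" using that by (intro power_mono) auto
        thus ?thesis by (simp add: \<psi>_def max_def power_divide)
      qed
      have "lap_le (\<lambda>w. \<psi> (g w)) z 0"
      proof (rule lap_le_touch[OF lap_le_const[of 0]])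
        show "\<forall>\<^sub>F w in nhds z. \<psi> (g w) \<le> 0" using ev by eventually_elim (simp add: z0)
        show "\<psi> (g z) = 0" using False by (simp add: z0)
      qed
      from lap_le_add[OF this kP] have "lap_le (\<lambda>w. S (g w)) z (0 + k * (\<Sum>a\<in>C. b a))"
        by (simp add: S_def)
      moreover have "0 + k * (\<Sum>a\<in>C. b a) \<le> 0" using ck b0 by (simp add: mult_nonneg_nonpos sum_nonpos)
      ultimately show ?thesis by (rule lap_le_mono)
    qed
  qed
qed

section \<open>Frontier points that follow an interior orbit\<close>

text \<open>This is a minimum principle. If no such frontier point exists, the set \<open>K\<close>
  where all \<open>g n\<close> stay within \<open>\<delta> n\<close> of their values at
  \<open>z0\<close> is a compact subset of \<open>V\<close>. The sum \<open>T\<close> of the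
  barriers is below 1 at \<open>z0\<close> and at least 1 wherever some distance reaches its bound,
  so a slight perturbation of \<open>T\<close> has a minimum in the interior of \<open>K\<close>,
  against its negative Laplacian.\<close>

lemma frontier_point_shadowing_finite:
  fixes g :: "nat \<Rightarrow> complex \<Rightarrow> complex"
  assumes V: "open V" "bounded V" and z0: "z0 \<in> V" and "finite I"
    and cont: "\<And>n. n \<in> I \<Longrightarrow> continuous_on (closure V) (g n)"
    and hol: "\<And>n. n \<in> I \<Longrightarrow> g n holomorphic_on V"
    and gopen: "\<And>n. n \<in> I \<Longrightarrow> open (g n ` V)"
    and gM: "\<And>n. n \<in> I \<Longrightarrow> g n ` V \<subseteq> ball 0 M"
    and d: "\<And>n. n \<in> I \<Longrightarrow> \<delta> n > 0"
    and small: "(\<Sum>n\<in>I. 8000 * M * measure lborel (g n ` V) / \<delta> n ^ 3) < 1"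
  shows "\<exists>w\<in>frontier V. \<forall>n\<in>I. dist (g n w) (g n z0) \<le> \<delta> n"
proof (rule ccontr)
  assume no: "\<not> (\<exists>w\<in>frontier V. \<forall>n\<in>I. dist (g n w) (g n z0) \<le> \<delta> n)"
  define K where "K = closure V \<inter> (\<Inter>n\<in>I. {z\<in>closure V. dist (g n z) (g n z0) \<le> \<delta> n})"
  have clV: "compact (closure V)" using V by (simp add: compact_closure)
  have cl: "closed {z\<in>closure V. dist (g n z) (g n z0) \<le> \<delta> n}" if "n \<in> I" for n
    using cont[OF that] by (intro continuous_on_closed_Collect_le continuous_intros) auto
  have "compact K" unfolding K_def using clV cl by (intro compact_Int_closed closed_INT) auto
  have KV: "K \<subseteq> V"
  proof
    fix z assume z: "z \<in> K"
    hence "z \<notin> frontier V" using no by (auto simp: K_def)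
    thus "z \<in> V" using z V by (auto simp: K_def frontier_def interior_open)
  qed
  have z0K: "z0 \<in> K" using z0 d closure_subset[of V] by (auto simp: K_def less_imp_le)
  have gK: "dist (g n z) (g n z0) \<le> \<delta> n" if "z \<in> K" "n \<in> I" for z n using that by (auto simp: K_def)
  have gb: "norm (g n z) < M" if "z \<in> V" "n \<in> I" for z n
    using gM[OF that(2)] that(1) by auto
  define barrier where "barrier = (\<lambda>n (S :: complex \<Rightarrow> real). continuous_on UNIV S \<and>
    (\<forall>x. norm x < M \<longrightarrow> 0 \<le> S x) \<and>
    (\<forall>x. norm x < M \<longrightarrow> \<delta> n \<le> dist x (g n z0) \<longrightarrow> 1 \<le> S x) \<and>
    S (g n z0) \<le> 8000 * M * measure lborel (g n ` V) / \<delta> n ^ 3 \<and>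
    (\<forall>z\<in>K. lap_le (\<lambda>w. S (g n w)) z 0))"
  have "\<exists>S. barrier n S" if n: "n \<in> I" for n
  proof -
    have Q: "compact (g n ` K)" "g n ` K \<subseteq> g n ` V"
      using \<open>compact K\<close> KV cont[OF n] closure_subset[of V]
      by (auto intro!: compact_continuous_image intro: continuous_on_subset)
    show ?thesis
    proof (rule thin_domain_barrier[OF gopen[OF n] gM[OF n] Q gb[OF z0 n] d[OF n]])
      fix S :: "complex \<Rightarrow> real"
      assume S: "continuous_on UNIV S" "\<And>x. norm x < M \<Longrightarrow> 0 \<le> S x"
        "\<And>x. norm x < M \<Longrightarrow> \<delta> n \<le> dist x (g n z0) \<Longrightarrow> 1 \<le> S x"
        "S (g n z0) \<le> 8000 * M * measure lborel (g n ` V) / \<delta> n ^ 3"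
        "\<And>h A z. open A \<Longrightarrow> h holomorphic_on A \<Longrightarrow> z \<in> A \<Longrightarrow> h z \<in> g n ` K \<Longrightarrow>
           dist (h z) (g n z0) \<le> \<delta> n \<Longrightarrow> lap_le (\<lambda>w. S (h w)) z 0"
      have "lap_le (\<lambda>w. S (g n w)) z 0" if "z \<in> K" for z
        by (rule S(5)[OF V(1) hol[OF n]]) (use that KV gK n in auto)
      thus ?thesis using S by (intro exI[of _ S]) (auto simp: barrier_def)
    qed
  qed
  then obtain S where "\<And>n. n \<in> I \<Longrightarrow> barrier n (S n)" by metis
  hence S_cont: "\<And>n. n \<in> I \<Longrightarrow> continuous_on UNIV (S n)"
    and S_nonneg: "\<And>n x. n \<in> I \<Longrightarrow> norm x < M \<Longrightarrow> 0 \<le> S n x"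
    and S_ge1: "\<And>n x. n \<in> I \<Longrightarrow> norm x < M \<Longrightarrow> \<delta> n \<le> dist x (g n z0) \<Longrightarrow> 1 \<le> S n x"
    and S_z0: "\<And>n. n \<in> I \<Longrightarrow> S n (g n z0) \<le> 8000 * M * measure lborel (g n ` V) / \<delta> n ^ 3"
    and S_lap: "\<And>n z. n \<in> I \<Longrightarrow> z \<in> K \<Longrightarrow> lap_le (\<lambda>w. S n (g n w)) z 0"
    unfolding barrier_def by simp_all
  define T where "T = (\<lambda>z. \<Sum>n\<in>I. S n (g n z))"
  have "T z0 \<le> (\<Sum>n\<in>I. 8000 * M * measure lborel (g n ` V) / \<delta> n ^ 3)"
    unfolding T_def by (intro sum_mono S_z0)
  hence Tz0: "T z0 < 1" using small by linarith
  obtain B where B: "B > 0" "\<And>z. z \<in> K \<Longrightarrow> dist z z0 \<le> B"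
    using compact_imp_bounded[OF \<open>compact K\<close>] unfolding bounded_any_center[of _ z0]
    by (metis dist_commute dual_order.trans less_imp_le linorder_not_le zero_less_one)
  \<comment> \<open>Subtracting \<open>e\<close> times the squared distance to \<open>z0\<close>
    makes the Laplacian at most \<open>-4 * e\<close>; this \<open>e\<close> uses only half of the
    gap \<open>1 - T z0\<close>, so \<open>T\<close> is still below 1 at the minimum.\<close>
  define e where "e = (1 - T z0) / (2 * B\<^sup>2)"
  have e: "e > 0" "T z0 + e * B\<^sup>2 < 1" using Tz0 B by (auto simp: e_def field_simps)
  have contT: "continuous_on K (\<lambda>z. T z + e * (- (norm (z - z0))\<^sup>2))"
    unfolding T_def
  proof (intro continuous_intros)
    fix n assume n: "n \<in> I"
    have "continuous_on K (g n)" using cont[OF n] KV closure_subset continuous_on_subset by blast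
    thus "continuous_on K (\<lambda>x. S n (g n x))"
      using continuous_on_compose2[OF S_cont[OF n]] by blast
  qed
  obtain zm where zm: "zm \<in> K"
    "\<And>z. z \<in> K \<Longrightarrow> T zm + e * (- (norm (zm - z0))\<^sup>2) \<le> T z + e * (- (norm (z - z0))\<^sup>2)"
    using continuous_attains_inf[OF \<open>compact K\<close> _ contT] z0K by blast
  have "(norm (zm - z0))\<^sup>2 \<le> B\<^sup>2" using B(2)[OF zm(1)] by (intro power_mono) (auto simp: dist_norm)
  hence "e * (norm (zm - z0))\<^sup>2 \<le> e * B\<^sup>2" using e by (intro mult_left_mono) auto
  moreover have "T zm - e * (norm (zm - z0))\<^sup>2 \<le> T z0" using zm(2)[OF z0K] by simp
  ultimately have Tzm: "T zm < 1" using e(2) by linarith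
  have zmV: "zm \<in> V" using zm KV by auto
  \<comment> \<open>A distance equal to \<open>\<delta> n\<close> would force
    \<open>T zm \<ge> 1\<close>. With all inequalities strict, a neighbourhood of \<open>zm\<close>
    lies in \<open>K\<close>.\<close>
  have strict: "dist (g n zm) (g n z0) < \<delta> n" if n: "n \<in> I" for n
  proof (rule ccontr)
    assume "\<not> ?thesis"
    hence "1 \<le> S n (g n zm)" using S_ge1[OF n gb[OF zmV n]] by simp
    also have "\<dots> \<le> T zm" unfolding T_def
      using \<open>finite I\<close> n S_nonneg gb[OF zmV] by (intro member_le_sum) auto
    finally show False using Tzm by simp
  qed
  have "\<forall>\<^sub>F z in nhds zm. z \<in> K"
  proof -
    have "\<forall>\<^sub>F z in nhds zm. dist (g n z) (g n z0) < \<delta> n" if n: "n \<in> I" for n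
    proof -
      have "isCont (g n) zm"
        using hol[OF n] V zmV holomorphic_on_imp_continuous_on continuous_on_eq_continuous_at by blast
      hence "((\<lambda>z. dist (g n z) (g n z0)) \<longlongrightarrow> dist (g n zm) (g n z0)) (nhds zm)"
        by (intro tendsto_intros) (simp add: continuous_at tendsto_at_iff_tendsto_nhds)
      thus ?thesis using strict[OF n] by (rule order_tendstoD(2))
    qed
    hence "\<forall>\<^sub>F z in nhds zm. \<forall>n\<in>I. dist (g n z) (g n z0) < \<delta> n"
      using \<open>finite I\<close> by (simp add: eventually_ball_finite)
    moreover have "\<forall>\<^sub>F z in nhds zm. z \<in> V" using V zmV by (intro eventually_nhds_in_open)
    ultimately show ?thesis
      by eventually_elim (use closure_subset[of V] in \<open>auto simp: K_def intro: less_imp_le\<close>)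
  qed
  hence lmin: "\<forall>\<^sub>F z in nhds zm. T zm + e * (- (norm (zm - z0))\<^sup>2) \<le> T z + e * (- (norm (z - z0))\<^sup>2)"
    by eventually_elim (rule zm(2))
  have "lap_le T zm (\<Sum>n\<in>I. 0)" unfolding T_def
    using \<open>finite I\<close> S_lap zm(1) by (intro lap_le_sum) auto
  moreover have "lap_le (\<lambda>z. - (norm (z - z0))\<^sup>2) zm (- 4 * (norm (deriv (\<lambda>z. z - z0) zm))\<^sup>2)"
    by (rule lap_le_norm_sq_holomorphic(2)[of _ UNIV]) (auto intro!: holomorphic_intros)
  moreover have "deriv (\<lambda>z. z - z0) zm = 1"
    by (rule DERIV_imp_deriv) (auto intro!: derivative_eq_intros)
  ultimately have "lap_le (\<lambda>z. T z + e * (- (norm (z - z0))\<^sup>2)) zm (0 + e * (- 4))"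
    using e by (intro lap_le_add lap_le_cmult) auto
  from not_local_min_if_lap_le_neg[OF this] lmin e show False by simp
qed

text \<open>The thresholds must tend to 0 while the weighted areas remain summable. With
  \<open>s\<close> the square root of the tail sum, \<open>a n / s n\<close> is dominated by a
  telescoping series, and the cube root of \<open>s\<close> absorbs the exponent 3.\<close>

lemma exists_null_sequence_cubic_summable:
  fixes a :: "nat \<Rightarrow> real"
  assumes "summable a" "\<And>n. a n > 0"
  obtains \<delta> where "\<And>n. \<delta> n > 0" "\<delta> \<longlonglongrightarrow> 0" "summable (\<lambda>n. a n / \<delta> n ^ 3)"
proof -
  define t where "t = (\<lambda>n. \<Sum>k. a (k + n))"
  have sm: "summable (\<lambda>k. a (k + n))" for n using assms(1) by (rule summable_ignore_initial_segment)
  have t_pos: "t n > 0" for n unfolding t_def using sm assms(2) by (intro suminf_pos) auto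
  have t_rec: "a n = t n - t (Suc n)" for n
    using suminf_split_head[OF sm[of n]] by (simp add: t_def)
  have t_lim: "t \<longlonglongrightarrow> 0" unfolding t_def by (rule suminf_exist_split2[OF assms(1)])
  \<comment> \<open>Dividing by the square root of the tail keeps the series summable.\<close>
  define s where "s = (\<lambda>n. sqrt (t n))"
  have s_pos: "s n > 0" for n by (simp add: s_def t_pos)
  have s_lim: "s \<longlonglongrightarrow> 0" unfolding s_def using tendsto_real_sqrt[OF t_lim] by simp
  have s_dec: "s (Suc n) \<le> s n" for n
    unfolding s_def using t_rec[of n] assms(2)[of n] by (intro real_sqrt_le_mono) linarith
  have bound: "a n / s n \<le> 2 * (s n - s (Suc n))" for n
  proof -
    have "a n = (s n - s (Suc n)) * (s n + s (Suc n))"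
      using t_pos[of n] t_pos[of "Suc n"] t_rec[of n] by (simp add: s_def algebra_simps)
    also have "\<dots> \<le> (s n - s (Suc n)) * (2 * s n)" using s_dec[of n] by (intro mult_left_mono) auto
    finally show ?thesis using s_pos[of n] by (simp add: field_simps)
  qed
  have "summable (\<lambda>n. 2 * (s n - s (Suc n)))"
    by (intro summable_mult) (use telescope_summable'[OF s_lim] in simp)
  hence "summable (\<lambda>n. a n / s n)"
    by (rule summable_comparison_test') (use bound assms(2) s_pos in \<open>auto simp: less_imp_le\<close>)
  moreover have "root 3 (s n) ^ 3 = s n" for n using s_pos[of n] by simp
  moreover have "(\<lambda>n. root 3 (s n)) \<longlonglongrightarrow> 0" using tendsto_real_root[OF s_lim, of 3] by simp
  ultimately show ?thesis using that[of "\<lambda>n. root 3 (s n)"] s_pos by simp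
qed

text \<open>Disjoint images in one disc have summable areas, so from some \<open>N\<close> on the
  total weight is below 1. The finite version then applies to every finite set of indices beyond
  \<open>N\<close>, and compactness of the frontier supplies one point for all of them.\<close>

theorem frontier_point_shadowing:
  fixes g :: "nat \<Rightarrow> complex \<Rightarrow> complex"
  assumes V: "open V" "bounded V" and z0: "z0 \<in> V"
    and cont: "\<And>n. continuous_on (closure V) (g n)"
    and hol: "\<And>n. g n holomorphic_on V"
    and gopen: "\<And>n. open (g n ` V)"
    and gM: "\<And>n. g n ` V \<subseteq> ball 0 M"
    and disj: "disjoint_family (\<lambda>n. g n ` V)"
  obtains w where "w \<in> frontier V" "(\<lambda>n. g n w - g n z0) \<longlonglongrightarrow> 0"
proof -
  define a where "a = (\<lambda>n. measure lborel (g n ` V))"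
  have fm: "g n ` V \<in> fmeasurable lborel" for n
    using gopen bounded_subset[OF bounded_ball gM[of n]]
    by (intro fmeasurableI emeasure_bounded_finite) auto
  have a_pos: "a n > 0" for n
  proof -
    obtain r where r: "r > 0" "ball (g n z0) r \<subseteq> g n ` V"
      using gopen[of n] z0 by (meson imageI openE)
    have "0 < measure lborel (ball (g n z0) r)" using r by simp
    also have "\<dots> \<le> a n" unfolding a_def
      by (rule measure_mono_fmeasurable) (use r fm in auto)
    finally show ?thesis .
  qed
  have "summable a"
  proof (rule summableI_nonneg_bounded[where x = "measure lborel (ball (0::complex) M)"])
    fix n :: nat
    show "0 \<le> a n" by (simp add: a_def)
    have "(\<Sum>i<n. a i) = measure lborel (\<Union>i<n. g i ` V)"
      unfolding a_def
      by (rule measure_UNION'[symmetric])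
         (use fm disj in \<open>auto simp: pairwise_def disjoint_family_on_def disjnt_def\<close>)
    also have "\<dots> \<le> measure lborel (ball (0::complex) M)"
      using gM gopen by (intro measure_mono_fmeasurable)
        (auto intro!: fmeasurableI emeasure_bounded_finite borel_open)
    finally show "(\<Sum>i<n. a i) \<le> measure lborel (ball (0::complex) M)" .
  qed
  then obtain \<delta> where \<delta>: "\<And>n. \<delta> n > 0" "\<delta> \<longlonglongrightarrow> 0" "summable (\<lambda>n. a n / \<delta> n ^ 3)"
    using exists_null_sequence_cubic_summable[of a] a_pos by blast
  have sm: "summable (\<lambda>n. 8000 * M * a n / \<delta> n ^ 3)"
    using summable_mult[OF \<delta>(3), of "8000 * M"] by simp
  have M: "M > 0" using gM[of 0] z0 by (metis ball_eq_empty empty_iff image_eqI linorder_not_le subsetD)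
  obtain N where N: "(\<Sum>k. 8000 * M * a (k + N) / \<delta> (k + N) ^ 3) < 1"
    using order_tendstoD(2)[OF suminf_exist_split2[OF sm], of 1] by (auto simp: eventually_sequentially)
  define F where "F = (\<lambda>k. {w \<in> frontier V. dist (g (k + N) w) (g (k + N) z0) \<le> \<delta> (k + N)})"
  have cf: "compact (frontier V)" using V by (simp add: compact_frontier_bounded)
  have clF: "closed (F k)" for k unfolding F_def
  proof (rule continuous_on_closed_Collect_le)
    show "continuous_on (frontier V) (\<lambda>w. dist (g (k + N) w) (g (k + N) z0))"
      using continuous_on_subset[OF cont[of "k + N"], of "frontier V"]
      by (intro continuous_intros) (auto simp: frontier_def)
  qed auto
  have fin: "frontier V \<inter> (\<Inter>k\<in>J. F k) \<noteq> {}" if J: "finite J" for J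
  proof -
    let ?I = "(\<lambda>k. k + N) ` J"
    have "(\<Sum>n\<in>?I. 8000 * M * a n / \<delta> n ^ 3) = (\<Sum>k\<in>J. 8000 * M * a (k + N) / \<delta> (k + N) ^ 3)"
      by (subst sum.reindex) (auto simp: inj_on_def)
    also have "\<dots> \<le> (\<Sum>k. 8000 * M * a (k + N) / \<delta> (k + N) ^ 3)"
      using summable_ignore_initial_segment[OF sm, of N] J M a_pos \<delta>(1)
      by (intro sum_le_suminf) (auto simp: less_imp_le)
    finally have "(\<Sum>n\<in>?I. 8000 * M * a n / \<delta> n ^ 3) < 1" using N by simp
    hence "\<exists>w\<in>frontier V. \<forall>n\<in>?I. dist (g n w) (g n z0) \<le> \<delta> n"
      unfolding a_def
      by (intro frontier_point_shadowing_finite[OF V z0]) (use J cont hol gopen gM \<delta>(1) in auto)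
    thus ?thesis by (auto simp: F_def)
  qed
  have "frontier V \<inter> (\<Inter>k\<in>UNIV. F k) \<noteq> {}"
    by (rule compact_imp_fip_image[OF cf clF fin])
  then obtain w where w: "w \<in> frontier V" "\<And>k. dist (g (k + N) w) (g (k + N) z0) \<le> \<delta> (k + N)"
    by (auto simp: F_def)
  have "(\<lambda>k. g (k + N) w - g (k + N) z0) \<longlonglongrightarrow> 0"
    by (rule Lim_null_comparison[OF _ LIMSEQ_ignore_initial_segment[OF \<delta>(2), of N]])
       (use w(2) in \<open>simp add: dist_norm\<close>)
  hence "(\<lambda>n. g n w - g n z0) \<longlonglongrightarrow> 0" by (rule LIMSEQ_offset)
  thus ?thesis using that w(1) by blast
qed

text \<open>In the coordinate \<open>1 / (x - b)\<close> a bounded orbit stays away from 0 and an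
  escaping orbit tends to 0; both properties survive a perturbation tending to 0.\<close>

lemma same_orbit_type_if_asymptotic:
  assumes "\<rho> > 0" and away: "\<And>n. \<rho> \<le> norm ((f ^^ n) z - b)" "\<And>n. \<rho> \<le> norm ((f ^^ n) w - b)"
    and lim: "(\<lambda>n. inverse ((f ^^ n) w - b) - inverse ((f ^^ n) z - b)) \<longlonglongrightarrow> 0"
  shows "same_orbit_type f z w"
proof -
  have BO: "y \<in> bounded_orbit_set f"
    if x: "x \<in> bounded_orbit_set f" and ax: "\<And>n. \<rho> \<le> norm ((f ^^ n) x - b)"
      and l: "(\<lambda>n. inverse ((f ^^ n) y - b) - inverse ((f ^^ n) x - b)) \<longlonglongrightarrow> 0" for x y
  proof -
    obtain K where K: "K > 0" "\<And>n. norm ((f ^^ n) x) < K"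
      using x by (auto simp: bounded_orbit_set_def)
    define c where "c = inverse (K + norm b)"
    have c: "c > 0" using K by (simp add: c_def add_pos_nonneg)
    have gx: "c \<le> norm (inverse ((f ^^ n) x - b))" for n
    proof -
      have "norm ((f ^^ n) x - b) \<le> K + norm b"
        using norm_triangle_ineq4[of "(f ^^ n) x" b] K(2)[of n] by linarith
      moreover have "0 < norm ((f ^^ n) x - b)" using ax[of n] \<open>\<rho> > 0\<close> by linarith
      ultimately show ?thesis unfolding c_def norm_inverse by (intro le_imp_inverse_le)
    qed
    have "\<forall>\<^sub>F n in sequentially. norm (inverse ((f ^^ n) y - b) - inverse ((f ^^ n) x - b)) < c/2"
      using tendstoD[OF l, of "c/2"] c by (simp add: dist_norm)
    hence "\<forall>\<^sub>F n in sequentially. norm ((f ^^ n) y) \<le> inverse (c/2) + norm b"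
    proof eventually_elim
      case (elim n)
      have "norm (inverse ((f ^^ n) x - b)) - norm (inverse ((f ^^ n) y - b))
             \<le> norm (inverse ((f ^^ n) y - b) - inverse ((f ^^ n) x - b))"
        by (metis norm_minus_commute norm_triangle_ineq2)
      hence "c/2 \<le> norm (inverse ((f ^^ n) y - b))" using gx[of n] elim by linarith
      hence "inverse (norm (inverse ((f ^^ n) y - b))) \<le> inverse (c/2)"
        using c by (intro le_imp_inverse_le) auto
      hence "norm ((f ^^ n) y - b) \<le> inverse (c/2)" by (simp add: norm_inverse)
      thus ?case using norm_triangle_ineq2[of "(f ^^ n) y" b] by linarith
    qed
    thus ?thesis unfolding bounded_orbit_set_iff by (rule BfunI)
  qed
  have ES: "y \<in> escaping_set f"
    if x: "x \<in> escaping_set f" and ay: "\<And>n. \<rho> \<le> norm ((f ^^ n) y - b)"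
      and l: "(\<lambda>n. inverse ((f ^^ n) y - b) - inverse ((f ^^ n) x - b)) \<longlonglongrightarrow> 0" for x y
  proof -
    have "filterlim (\<lambda>n. - b + (f ^^ n) x) at_infinity sequentially"
      using x unfolding escaping_set_def by (intro tendsto_add_filterlim_at_infinity[OF tendsto_const]) simp
    hence "(\<lambda>n. inverse ((f ^^ n) x - b)) \<longlonglongrightarrow> 0"
      using filterlim_compose[OF tendsto_inverse_0] by simp
    from tendsto_add[OF l this] have "(\<lambda>n. inverse ((f ^^ n) y - b)) \<longlonglongrightarrow> 0" by simp
    \<comment> \<open>As \<open>inverse 0 = 0\<close>, an orbit point equal to \<open>b\<close>
      would look like infinity; the distance \<open>\<rho>\<close> excludes this.\<close>
    moreover have "(f ^^ n) y \<noteq> b" for n using ay[of n] \<open>\<rho> > 0\<close> by auto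
    ultimately have "filterlim (\<lambda>n. inverse ((f ^^ n) y - b)) (at 0) sequentially"
      by (simp add: filterlim_at)
    hence "filterlim (\<lambda>n. (f ^^ n) y - b) at_infinity sequentially"
      by (simp add: filterlim_inverse_at_iff)
    from tendsto_add_filterlim_at_infinity[OF tendsto_const[of b] this]
    show ?thesis by (simp add: escaping_set_def)
  qed
  have lim': "(\<lambda>n. inverse ((f ^^ n) z - b) - inverse ((f ^^ n) w - b)) \<longlonglongrightarrow> 0"
    using tendsto_minus[OF lim] by simp
  show ?thesis unfolding same_orbit_type_def
    using BO[OF _ away(1) lim] BO[OF _ away(2) lim'] ES[OF _ away(2) lim] ES[OF _ away(1) lim'] by blast
qed

section \<open>Iterated images of a bounded domain\<close>

lemma frontier_image_subset:
  fixes h :: "complex \<Rightarrow> complex"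
  assumes "continuous_on UNIV h" "bounded X" "open X" "open (h ` X)"
  shows "frontier (h ` X) \<subseteq> h ` frontier X"
proof
  fix y assume y: "y \<in> frontier (h ` X)"
  have "compact (h ` closure X)"
    using assms by (intro compact_continuous_image) (auto intro: continuous_on_subset simp: compact_closure)
  hence "closure (h ` X) \<subseteq> h ` closure X"
    by (intro closure_minimal image_mono closure_subset compact_imp_closed)
  then obtain x where "x \<in> closure X" "y = h x" "y \<notin> h ` X"
    using y assms by (auto simp: frontier_def interior_open)
  thus "y \<in> h ` frontier X" using assms by (auto simp: frontier_def interior_open)
qed

lemma connected_subset_if_avoids_frontier:
  assumes "connected S" "S \<inter> T \<noteq> {}" "S \<inter> frontier T = {}"
  shows "S \<subseteq> T"
  using connected_Int_frontier[OF assms(1,2)] assms(3) by blast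

theorem bounded_open_avoids_orbit_class:
  assumes hol: "f holomorphic_on UNIV" and nonconst: "\<not> f constant_on UNIV"
    and sat: "\<And>z w. same_orbit_type f z w \<Longrightarrow> z \<in> E \<Longrightarrow> w \<in> E"
    and U: "open U" "connected U" "\<not> bounded U" "U \<subseteq> E"
    and G: "open G" "bounded G" "frontier G \<inter> E = {}"
  shows "G \<inter> E = {}"
proof (rule ccontr)
  assume GE: "G \<inter> E \<noteq> {}"
  have inv: "(f ^^ n) z \<in> E \<longleftrightarrow> z \<in> E" for n z
    using sat same_orbit_type_funpow same_orbit_type_sym by blast
  have holn: "f ^^ n holomorphic_on UNIV" for n
  proof (induction n)
    case (Suc n)
    show ?case using holomorphic_on_compose_gen[OF Suc hol] by (simp del: o_apply)
  qed (simp add: holomorphic_on_id[unfolded id_def] id_def)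
  have contn: "continuous_on X (f ^^ n)" for n X
    using holomorphic_on_imp_continuous_on[OF holn] continuous_on_subset by blast
  have openn: "open ((f ^^ n) ` X)" if "open X" for n X
  proof (induction n)
    case (Suc n)
    have "(f ^^ Suc n) ` X = f ` ((f ^^ n) ` X)" by (simp add: image_comp)
    thus ?case using open_mapping_thm[OF hol _ connected_UNIV Suc _ nonconst] by simp
  qed (use that in simp)
  have image: "frontier ((f ^^ n) ` X) \<inter> E = {}" "bounded ((f ^^ n) ` X)" "(f ^^ n) ` X \<inter> U = {}"
    if X: "open X" "bounded X" "frontier X \<inter> E = {}" for X n
  proof -
    have "frontier ((f ^^ n) ` X) \<subseteq> (f ^^ n) ` frontier X"
      using X contn openn by (intro frontier_image_subset) auto
    thus fr: "frontier ((f ^^ n) ` X) \<inter> E = {}" using X(3) inv by blast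
    have "compact ((f ^^ n) ` closure X)"
      using X by (intro compact_continuous_image contn) (simp add: compact_closure)
    thus bd: "bounded ((f ^^ n) ` X)"
      by (meson bounded_subset closure_subset compact_imp_bounded image_mono)
    show "(f ^^ n) ` X \<inter> U = {}"
    proof (rule ccontr)
      \<comment> \<open>Being connected and inside \<open>E\<close>, \<open>U\<close> cannot cross
        the frontier of the image, so it would be contained in a bounded set.\<close>
      assume "(f ^^ n) ` X \<inter> U \<noteq> {}"
      hence "U \<subseteq> (f ^^ n) ` X"
        using U fr by (intro connected_subset_if_avoids_frontier) auto
      thus False using U bd bounded_subset by blast
    qed
  qed
  have "U \<noteq> {}" using U(3) by auto
  then obtain b \<rho> where b: "\<rho> > 0" "ball b \<rho> \<subseteq> U" using U(1) by (meson all_not_in_conv openE)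
  have away: "\<rho> \<le> norm ((f ^^ n) z - b)" if X: "open X" "bounded X" "frontier X \<inter> E = {}" "z \<in> X" for X n z
  proof (rule ccontr)
    assume "\<not> ?thesis"
    hence "(f ^^ n) z \<in> U" using b by (auto simp: dist_norm norm_minus_commute)
    thus False using image(3)[OF X(1-3), of n] X(4) by blast
  qed
  \<comment> \<open>All iterates omit the disc about \<open>b\<close> on \<open>G\<close>, hence are
    normal there, and the orbit type is locally constant on \<open>G\<close>.\<close>
  have nbhd: "\<exists>r>0. ball z r \<subseteq> G \<and> (\<forall>x\<in>ball z r. x \<in> E \<longleftrightarrow> z \<in> E)" if "z \<in> G" for z
  proof -
    obtain r where r: "r > 0" "ball z r \<subseteq> G" using G(1) \<open>z \<in> G\<close> by (meson openE)
    have "normal_family_on {f ^^ n |n. True} (ball z r)"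
    proof (rule normal_family_on_ball_omitting_disc[of _ _ _ \<rho> b])
      show "h holomorphic_on ball z r" if "h \<in> {f ^^ n |n. True}" for h
        using that holn holomorphic_on_subset by blast
      show "\<rho> \<le> norm (h x - b)" if "h \<in> {f ^^ n |n. True}" "x \<in> ball z r" for h x
        using that r away[OF G] by blast
    qed (use b in auto)
    hence "same_orbit_type f x z" if "x \<in> ball z r" for x
      using same_orbit_type_if_normal that r by (metis centre_in_ball)
    thus ?thesis using r sat same_orbit_type_sym by blast
  qed
  have openGE: "open (G \<inter> E)"
    unfolding open_contains_ball
  proof
    fix z assume "z \<in> G \<inter> E"
    thus "\<exists>e>0. ball z e \<subseteq> G \<inter> E" using nbhd[of z] by blast
  qed
  obtain z0 where z0: "z0 \<in> G \<inter> E" using GE by blast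
  define V where "V = connected_component_set (G \<inter> E) z0"
  have z0V: "z0 \<in> V" using z0 by (simp add: V_def connected_component_refl)
  have VGE: "V \<subseteq> G \<inter> E" unfolding V_def by (rule connected_component_subset)
  have Vopen: "open V" unfolding V_def by (rule open_connected_component[OF openGE])
  have Vconn: "connected V" by (simp add: V_def)
  have Vbdd: "bounded V" using VGE G(2) by (meson bounded_Int bounded_subset)
  \<comment> \<open>A frontier point of \<open>V\<close> in \<open>E\<close> lies in the closure of
    \<open>G\<close> but not on its frontier, hence in \<open>G \<inter> E\<close>, where the
    component \<open>V\<close> is relatively closed.\<close>
  have Vfr: "frontier V \<inter> E = {}"
  proof -
    have False if w: "w \<in> frontier V" "w \<in> E" for w
    proof -
      have wcl: "w \<in> closure V" "w \<notin> V" using w Vopen by (auto simp: frontier_def interior_open)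
      have "w \<in> closure G" using wcl VGE closure_mono[of V G] by blast
      hence "w \<in> G" using G w by (auto simp: frontier_def interior_open)
      hence wGE: "w \<in> G \<inter> E" using w by simp
      have "closedin (top_of_set (G \<inter> E)) V" unfolding V_def by (rule closedin_connected_component)
      hence "w \<in> V" using wcl wGE by (auto simp: closedin_closed closure_subset dest: closure_minimal[THEN subsetD, rotated 2])
      thus False using wcl by blast
    qed
    thus ?thesis by blast
  qed
  note X = Vopen Vbdd Vfr
  have eq_or_disjoint: "(f ^^ n) ` V = (f ^^ m) ` V" if "(f ^^ n) ` V \<inter> (f ^^ m) ` V \<noteq> {}" for n m
  proof -
    have sub: "(f ^^ i) ` V \<subseteq> (f ^^ j) ` V" if "(f ^^ i) ` V \<inter> (f ^^ j) ` V \<noteq> {}" for i j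
    proof (rule connected_subset_if_avoids_frontier[OF _ that])
      show "connected ((f ^^ i) ` V)" by (intro connected_continuous_image contn Vconn)
      have "(f ^^ i) ` V \<subseteq> E" using VGE inv by blast
      thus "(f ^^ i) ` V \<inter> frontier ((f ^^ j) ` V) = {}" using image(1)[OF X, of j] by blast
    qed
    show ?thesis using sub[of n m] sub[of m n] that by blast
  qed
  show False
  proof (cases "\<exists>n m. n < m \<and> (f ^^ n) ` V = (f ^^ m) ` V")
    case True
    then obtain n m where nm: "n < m" "(f ^^ n) ` V = (f ^^ m) ` V" by blast
    \<comment> \<open>The images are eventually periodic: for \<open>k \<ge> m\<close> the exponent
      may be replaced by \<open>k - m + n\<close>, which is smaller because
      \<open>n < m\<close>.\<close>
    have "\<exists>j<m. (f ^^ k) ` V = (f ^^ j) ` V" for k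
    proof (induction k rule: less_induct)
      case (less k)
      show ?case
      proof (cases "k < m")
        case False
        have "(f ^^ k) ` V = (f ^^ (k - m)) ` ((f ^^ m) ` V)"
          using False by (simp add: image_comp flip: funpow_add)
        also have "\<dots> = (f ^^ (k - m)) ` ((f ^^ n) ` V)" by (simp only: nm)
        also have "\<dots> = (f ^^ (k - m + n)) ` V" by (simp add: image_comp funpow_add)
        finally show ?thesis using less[of "k - m + n"] False nm(1) by auto
      qed blast
    qed
    hence sub: "(f ^^ k) ` V \<subseteq> (\<Union>j<m. (f ^^ j) ` V)" for k by blast
    have "bounded (\<Union>j<m. (f ^^ j) ` V)" using image(2)[OF X] by (intro bounded_UN) auto
    then obtain B where B: "\<And>z. z \<in> (\<Union>j<m. (f ^^ j) ` V) \<Longrightarrow> norm z \<le> B" by (auto simp: bounded_iff)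
    \<comment> \<open>The uniform bound passes to the closure by continuity, so frontier points
      share the orbit type of \<open>z0\<close>.\<close>
    have bo: "z \<in> bounded_orbit_set f" if "z \<in> closure V" for z
    proof -
      have "norm ((f ^^ k) z) \<le> B" for k
      proof -
        have "V \<subseteq> {z. norm ((f ^^ k) z) \<le> B}" using sub[of k] B by blast
        moreover have "closed {z. norm ((f ^^ k) z) \<le> B}"
          by (intro closed_Collect_le continuous_intros contn)
        ultimately show ?thesis using that closure_minimal by blast
      qed
      thus ?thesis unfolding bounded_orbit_set_iff by (rule BseqI')
    qed
    have not_esc: "z \<notin> escaping_set f" if "z \<in> bounded_orbit_set f" for z
    proof
      obtain K where K: "\<And>n. norm ((f ^^ n) z) < K"
        using \<open>z \<in> bounded_orbit_set f\<close> by (auto simp: bounded_orbit_set_def)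
      assume "z \<in> escaping_set f"
      hence "\<forall>\<^sub>F n in sequentially. K \<le> norm ((f ^^ n) z)"
        unfolding escaping_set_iff filterlim_at_top by blast
      then obtain n where "K \<le> norm ((f ^^ n) z)" by (auto simp: eventually_sequentially)
      thus False using K[of n] by simp
    qed
    have "frontier V \<noteq> {}"
      using Vbdd z0V by (metis bounded_empty empty_iff frontier_eq_empty not_bounded_UNIV)
    then obtain w where w: "w \<in> frontier V" by blast
    have "z0 \<in> closure V" "w \<in> closure V" using z0V w closure_subset by (auto simp: frontier_def)
    hence "same_orbit_type f z0 w"
      using bo not_esc by (auto simp: same_orbit_type_def)
    thus False using sat z0 w Vfr by blast
  next
    case False
    have disj: "(f ^^ n) ` V \<inter> (f ^^ m) ` V = {}" if "n \<noteq> m" for n m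
    proof (rule ccontr)
      assume "(f ^^ n) ` V \<inter> (f ^^ m) ` V \<noteq> {}"
      hence "(f ^^ n) ` V = (f ^^ m) ` V" by (rule eq_or_disjoint)
      thus False using that False by (metis nat_neq_iff)
    qed
    have awaycl: "\<rho> \<le> norm ((f ^^ n) z - b)" if "z \<in> closure V" for n z
    proof -
      have "V \<subseteq> {z. \<rho> \<le> norm ((f ^^ n) z - b)}" using away[OF X] by blast
      moreover have "closed {z. \<rho> \<le> norm ((f ^^ n) z - b)}"
        by (intro closed_Collect_le continuous_intros contn)
      ultimately show ?thesis using that closure_minimal by blast
    qed
    hence ne: "(f ^^ n) z - b \<noteq> 0" if "z \<in> closure V" for n z
      using that b(1) by (metis linorder_not_le norm_zero)
    define g where "g = (\<lambda>n z. inverse ((f ^^ n) z - b))"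
    have g_image: "g n ` V = (\<lambda>x. inverse (x - b)) ` ((f ^^ n) ` V)" for n
      by (auto simp: g_def)
    obtain w where w: "w \<in> frontier V" "(\<lambda>n. g n w - g n z0) \<longlonglongrightarrow> 0"
    proof (rule frontier_point_shadowing[OF Vopen Vbdd z0V, of g "inverse \<rho> + 1"])
      fix n
      show "continuous_on (closure V) (g n)"
        unfolding g_def using ne by (intro continuous_intros contn) auto
      show "g n holomorphic_on V" unfolding g_def
        using ne closure_subset[of V] holomorphic_on_subset[OF holn] by (intro holomorphic_intros) auto
      show "open (g n ` V)" unfolding g_image
      proof (rule open_mapping_thm3)
        show "(\<lambda>x. inverse (x - b)) holomorphic_on (f ^^ n) ` V"
          using ne closure_subset[of V] by (intro holomorphic_intros) auto
        show "open ((f ^^ n) ` V)" by (rule openn[OF Vopen])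
      qed (auto simp: inj_on_def)
      \<comment> \<open>The added 1 places the values of modulus at most
        \<open>inverse \<rho>\<close> in an open disc.\<close>
      show "g n ` V \<subseteq> ball 0 (inverse \<rho> + 1)"
      proof
        fix x assume "x \<in> g n ` V"
        then obtain z where z: "z \<in> V" "x = g n z" by blast
        have "norm (g n z) \<le> inverse \<rho>"
          unfolding g_def norm_inverse using away[OF X z(1)] b(1) by (intro le_imp_inverse_le)
        thus "x \<in> ball 0 (inverse \<rho> + 1)" using z by simp
      qed
    next
      show "disjoint_family (\<lambda>n. g n ` V)"
        unfolding disjoint_family_on_def
      proof (intro ballI impI)
        fix n m :: nat assume "n \<noteq> m"
        have "inj (\<lambda>x. inverse (x - b))" by (auto simp: inj_def)
        thus "g n ` V \<inter> g m ` V = {}" unfolding g_image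
          using disj[OF \<open>n \<noteq> m\<close>] by (metis image_Int image_empty)
      qed
    qed
    have "z0 \<in> closure V" "w \<in> closure V" using z0V w closure_subset by (auto simp: frontier_def)
    hence "same_orbit_type f z0 w"
      using awaycl w(2) by (intro same_orbit_type_if_asymptotic[OF b(1)]) (auto simp: g_def)
    thus False using sat z0 w Vfr by blast
  qed
qed

lemma open_fatou_set: "open (fatou_set f)"
proof (subst open_subopen, intro ballI)
  fix z assume "z \<in> fatou_set f"
  then obtain U where "open U" "z \<in> U" "normal_family_on {f ^^ n |n. True} U"
    unfolding fatou_set_def by blast
  thus "\<exists>T. open T \<and> z \<in> T \<and> T \<subseteq> fatou_set f" unfolding fatou_set_def by blast
qed

theorem theorem1p2:
  fixes f :: "complex \<Rightarrow> complex"
  assumes "transcendental_entire f"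
  shows "((\<exists>U\<in>fatou_components f. \<not> bounded U \<and> U \<subseteq> bounded_orbit_set f)
            \<longrightarrow> connectedin riemann_sphere (Some ` bounded_orbit_set f \<union> {None}))
       \<and> ((\<exists>U\<in>fatou_components f. \<not> bounded U \<and> U \<subseteq> bungee_set f)
            \<longrightarrow> connectedin riemann_sphere (Some ` bungee_set f \<union> {None}))"
proof -
  have hol: "f holomorphic_on UNIV" and np: "\<not> (\<exists>p. \<forall>z. f z = poly p z)"
    using assms by (auto simp: transcendental_entire_def)
  have nonconst: "\<not> f constant_on UNIV"
  proof
    assume "f constant_on UNIV"
    then obtain c where "\<And>z. f z = c" by (auto simp: constant_on_def)
    hence "\<forall>z. f z = poly [:c:] z" by simp
    thus False using np by blast
  qed
  have *: "connectedin riemann_sphere (Some ` E \<union> {None})"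
    if U: "U \<in> fatou_components f" "\<not> bounded U" "U \<subseteq> E"
      and sat: "\<And>z w. same_orbit_type f z w \<Longrightarrow> z \<in> E \<Longrightarrow> w \<in> E" for U E
  proof (rule connectedin_riemann_sphere_insert_infinity)
    have "open U" "connected U"
      using U(1) open_components[OF open_fatou_set] in_components_connected
      unfolding fatou_components_def by blast+
    thus "G \<inter> E = {}" if "open G" "bounded G" "frontier G \<inter> E = {}" for G
      using sat U(2,3) that by (intro bounded_open_avoids_orbit_class[OF hol nonconst, of E U G]) auto
  qed
  \<comment> \<open>The bungee set is closed under \<open>same_orbit_type\<close> as the complement
    of two sets with that property.\<close>
  show ?thesis
    using *[of _ "bounded_orbit_set f"] *[of _ "bungee_set f"]
    by (auto simp: same_orbit_type_def bungee_set_def)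
qed

end
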